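(* Let $K$ be an algebraically closed field, complete with respect to a non-archimedean absolute value $|\cdot|$, with valuation ring $\mathcal{O}$, maximal ideal $\mathfrak{m}$ and residue field $k=\mathcal{O}/\mathfrak{m}$. Let $\varphi\in K(z)$ be a rational map of degree $2$, and let $\xi$ be the unique point of $\mathbb{P}^1_{\mathrm{Berk}}$ with $w_\varphi(\xi)>0$ (the unique point of the crucial set of $\varphi$). Let $\lambda_1,\lambda_2,\lambda_3$ be the multipliers of $\varphi$ at its three classical fixed points (listed with multiplicity), $\sigma_1=\lambda_1+\lambda_2+\lambda_3$, $\sigma_2=\lambda_1\lambda_2+\lambda_1\lambda_3+\lambda_2\lambda_3$, and $\mathbf{s}([\varphi])=[\sigma_1:\sigma_2:1]\in\mathbb{P}^2(K)$. Then: (A) $\widetilde{\mathbf{s}([\varphi])}\in\mathbb{A}^2(k)=\{[\tilde x:\tilde y:\tilde 1]\}$ if and only if $\xi$ satisfies (W1); (B) $\widetilde{\mathbf{s}([\varphi])}=[\tilde 1:\tilde x:\tilde 0]$ for some $\tilde x\in k$ with $\tilde x\neq\tilde 2$ if and only if $\xi$ satisfies (W2); in this case $\tilde x=\tilde\lambda+\tilde\lambda^{-1}$, where $\lambda$ is the multiplier of $\varphi$ at a classical indifferent fixed point; (C) $\widetilde{\mathbf{s}([\varphi])}=[\tilde 1:\tilde 2:\tilde 0]$ if and only if $\xi$ satisfies (W3); (D) $\widetilde{\mathbf{s}([\varphi])}=[\tilde 0:\tilde 1:\tilde 0]$ if and only if $\xi$ satisfies (W4).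
   Context: $\mathbb{P}^1_{\mathrm{Berk}}$ is the Berkovich projective line over $K$; for $a\in K$, $r>0$, $\zeta_{D(a,r)}$ denotes the point corresponding to the sup-norm on the disc $D(a,r)=\{x:|x-a|\le r\}$; it is of type II when $r\in|K^\times|$; $\zeta_G=\zeta_{D(0,1)}$ is the Gauss point. $\varphi$ acts continuously on $\mathbb{P}^1_{\mathrm{Berk}}$. For a rational map $\psi$, a normalized lift is a pair $[F,G]$ of homogeneous polynomials with coefficients in $\mathcal{O}$, at least one a unit, with $\psi=F(z,1)/G(z,1)$; the reduction $\tilde\psi$ is obtained by reducing the coefficients mod $\mathfrak{m}$ and cancelling common factors. For a type II point $P$, choose $\gamma\in\mathrm{PGL}_2(K)$ with $\gamma(\zeta_G)=P$ and set $\tilde\varphi_P:=\widetilde{\gamma^{-1}\circ\varphi\circ\gamma}$ (well-defined up to $\mathrm{PGL}_2(k)$-conjugacy). A type II point $P$ is fixed by $\varphi$ iff $\tilde\varphi_P$ is nonconstant. The tangent directions at a type II point $P$ correspond to $\mathbb{P}^1(k)$ and $\varphi_*$ acts on them via $\tilde\varphi_P$ when $P$ is fixed. Let $\Gamma_{\mathrm{Fix}}$ be the subtree of $\mathbb{P}^1_{\mathrm{Berk}}$ spanned by the classical fixed points of $\varphi$ and $\Gamma_{\mathrm{Fix,Repel}}$ the tree spanned by the classical fixed points and the type II fixed points $P$ with $\deg\tilde\varphi_P\ge2$; $v(P)$ is the valence of $P$ in $\Gamma_{\mathrm{Fix,Repel}}$ (0 if $P\notin\Gamma_{\mathrm{Fix,Repel}}$).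 Weights: if $P$ is a type II fixed point, $w_\varphi(P)=\deg\tilde\varphi_P-1+N(P)$, where $N(P)$ is the number of tangent directions at $P$ containing classical fixed points that are moved by $\varphi_*$; if $P$ is a branch point of $\Gamma_{\mathrm{Fix}}$ moved by $\varphi$, $w_\varphi(P)=v(P)-2$; otherwise $w_\varphi(P)=0$. The weights sum to $\deg\varphi-1=1$. Conditions on a type II point $P$: (W1) $P$ is fixed and $\deg\tilde\varphi_P\ge2$; (W2) $P$ is fixed, $\tilde\varphi_P$ is conjugate over $k$ to $z\mapsto \tilde c z$ with $\tilde c\in k^\times$, $\tilde c\ne\tilde1$, and $P$ is a branch point of $\Gamma_{\mathrm{Fix}}$; (W3) $P$ is fixed, $\tilde\varphi_P$ is conjugate to $z\mapsto z+\tilde a$ with $\tilde a\in k^\times$, and $P\in\Gamma_{\mathrm{Fix}}$; (W4) $P$ is a branch point of $\Gamma_{\mathrm{Fix}}$ moved by $\varphi$. The multiplier at a fixed point $\alpha$ is $\varphi'(\alpha)$ (computed in a coordinate chart at $\infty$ if needed); $\alpha$ is indifferent if $|\varphi'(\alpha)|=1$. For $P\in\mathbb{P}^2(K)$, $\tilde P\in\mathbb{P}^2(k)$ is its specialization: scale homogeneous coordinates to lie in $\mathcal{O}$ with one a unit and reduce mod $\mathfrak{m}$. *)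

theory Defs
  imports "HOL-Computational_Algebra.Computational_Algebra" "HOL-Library.Multiset"
begin

definition nonarch_abs :: "('a::field \<Rightarrow> real) \<Rightarrow> bool" where
  "nonarch_abs nv \<longleftrightarrow> (\<forall>x. nv x \<ge> 0) \<and> (\<forall>x. nv x = 0 \<longleftrightarrow> x = 0)
     \<and> (\<forall>x y. nv (x * y) = nv x * nv y) \<and> (\<forall>x y. nv (x + y) \<le> max (nv x) (nv y))"

definition nontrivial_abs :: "('a::field \<Rightarrow> real) \<Rightarrow> bool" where
  "nontrivial_abs nv \<longleftrightarrow> (\<exists>x. x \<noteq> 0 \<and> nv x \<noteq> 1)"

definition complete_abs :: "('a::field \<Rightarrow> real) \<Rightarrow> bool" where
  "complete_abs nv \<longleftrightarrow> (\<forall>X :: nat \<Rightarrow> 'a.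
     (\<forall>e>0. \<exists>N. \<forall>m\<ge>N. \<forall>n\<ge>N. nv (X m - X n) < e) \<longrightarrow>
     (\<exists>L. (\<lambda>n. nv (X n - L)) \<longlonglongrightarrow> 0))"

definition residue_map :: "('a::field \<Rightarrow> real) \<Rightarrow> ('a \<Rightarrow> 'k::field_gcd) \<Rightarrow> bool" where
  "residue_map nv red \<longleftrightarrow>
     (\<forall>x y. nv x \<le> 1 \<longrightarrow> nv y \<le> 1 \<longrightarrow> red (x + y) = red x + red y \<and> red (x * y) = red x * red y)
     \<and> red 1 = 1
     \<and> (\<forall>x. nv x \<le> 1 \<longrightarrow> (red x = 0 \<longleftrightarrow> nv x < 1))
     \<and> (\<forall>u. \<exists>x. nv x \<le> 1 \<and> red x = u)"

definition rat_deg2 :: "'a::field poly \<Rightarrow> 'a poly \<Rightarrow> bool" where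
  "rat_deg2 F G \<longleftrightarrow> coprime F G \<and> max (degree F) (degree G) = 2"

text \<open>Lift of gamma^{-1} o phi o gamma for gamma(z) = a + c z (formal degree 2).\<close>
definition conj_pair :: "'a::field poly \<Rightarrow> 'a poly \<Rightarrow> 'a \<Rightarrow> 'a \<Rightarrow> 'a poly \<times> 'a poly" where
  "conj_pair F G a c =
     (let F1 = pcompose F [:a, c:]; G1 = pcompose G [:a, c:] in (F1 - smult a G1, smult c G1))"

definition red_pair :: "('a::field \<Rightarrow> real) \<Rightarrow> ('a \<Rightarrow> 'k::field_gcd) \<Rightarrow> 'a poly \<times> 'a poly \<Rightarrow> 'k poly \<times> 'k poly" where
  "red_pair nv red PQ =
     (let S = {coeff (fst PQ) i | i. i \<le> 2} \<union> {coeff (snd PQ) i | i. i \<le> 2};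
          t = (SOME t. t \<in> S \<and> (\<forall>s\<in>S. nv s \<le> nv t))
      in (map_poly red (smult (inverse t) (fst PQ)), map_poly red (smult (inverse t) (snd PQ))))"

text \<open>Cancel common factors of a pair of binary forms of degree 2 (given dehomogenized);
  returns the reduced pair and its degree.\<close>
definition cancel_pair :: "'k::field_gcd poly \<times> 'k poly \<Rightarrow> 'k poly \<times> 'k poly \<times> nat" where
  "cancel_pair fg =
     (let f = fst fg; g = snd fg; h = gcd f g; j = min (2 - degree f) (2 - degree g)
      in (f div h, g div h, 2 - degree h - j))"

text \<open>Action of a reduced map of degree e on P^1(k) = 'k option (None = infinity).\<close>
definition eval_red :: "'k::field_gcd poly \<times> 'k poly \<times> nat \<Rightarrow> 'k option \<Rightarrow> 'k option" where
  "eval_red fge z = (let f = fst fge; g = fst (snd fge); e = snd (snd fge) in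
     (case z of Some x \<Rightarrow> (if poly g x = 0 then None else Some (poly f x / poly g x))
              | None \<Rightarrow> (if coeff g e = 0 then None else Some (coeff f e / coeff g e))))"

text \<open>tilde-phi_P for the type II point P = zeta_{D(a,|c|)}, c \<noteq> 0, using gamma(z) = a + c z.\<close>
definition psi_red :: "('a::field \<Rightarrow> real) \<Rightarrow> ('a \<Rightarrow> 'k::field_gcd) \<Rightarrow> 'a poly \<Rightarrow> 'a poly \<Rightarrow> 'a \<Rightarrow> 'a \<Rightarrow> 'k poly \<times> 'k poly \<times> nat" where
  "psi_red nv red F G a c = cancel_pair (red_pair nv red (conj_pair F G a c))"

definition deg_red :: "('a::field \<Rightarrow> real) \<Rightarrow> ('a \<Rightarrow> 'k::field_gcd) \<Rightarrow> 'a poly \<Rightarrow> 'a poly \<Rightarrow> 'a \<Rightarrow> 'a \<Rightarrow> nat" where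
  "deg_red nv red F G a c = snd (snd (psi_red nv red F G a c))"

definition fixed_II :: "('a::field \<Rightarrow> real) \<Rightarrow> ('a \<Rightarrow> 'k::field_gcd) \<Rightarrow> 'a poly \<Rightarrow> 'a poly \<Rightarrow> 'a \<Rightarrow> 'a \<Rightarrow> bool" where
  "fixed_II nv red F G a c \<longleftrightarrow> deg_red nv red F G a c \<ge> 1"

definition same_point :: "('a::field \<Rightarrow> real) \<Rightarrow> 'a \<Rightarrow> 'a \<Rightarrow> 'a \<Rightarrow> 'a \<Rightarrow> bool" where
  "same_point nv a c b d \<longleftrightarrow> nv c = nv d \<and> nv (b - a) \<le> nv c"

definition fix_poly :: "'a::field poly \<Rightarrow> 'a poly \<Rightarrow> 'a poly" where
  "fix_poly F G = [:0, 1:] * G - F"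

definition is_fixed :: "'a::field poly \<Rightarrow> 'a poly \<Rightarrow> 'a option \<Rightarrow> bool" where
  "is_fixed F G \<alpha> = (case \<alpha> of Some x \<Rightarrow> poly (fix_poly F G) x = 0
                             | None \<Rightarrow> degree (fix_poly F G) < 3)"

definition multiplier :: "'a::field poly \<Rightarrow> 'a poly \<Rightarrow> 'a option \<Rightarrow> 'a" where
  "multiplier F G \<alpha> = (case \<alpha> of
      Some x \<Rightarrow> (poly (pderiv F) x * poly G x - poly F x * poly (pderiv G) x) / (poly G x)^2
    | None \<Rightarrow> (coeff G 1 * coeff F 2 - coeff G 2 * coeff F 1) / (coeff F 2)^2)"

definition fix_mults :: "'a::field poly \<Rightarrow> 'a poly \<Rightarrow> 'a multiset" where
  "fix_mults F G = (let p = fix_poly F G in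
     (\<Sum>x\<in>{x. poly p x = 0}. replicate_mset (order x p) (multiplier F G (Some x)))
     + replicate_mset (3 - degree p) (multiplier F G None))"

definition sym_poly :: "'a::field poly \<Rightarrow> 'a poly \<Rightarrow> 'a poly" where
  "sym_poly F G = prod_mset (image_mset (\<lambda>l. [:l, 1:]) (fix_mults F G))"

definition sigma1 :: "'a::field poly \<Rightarrow> 'a poly \<Rightarrow> 'a" where
  "sigma1 F G = coeff (sym_poly F G) 2"

definition sigma2 :: "'a::field poly \<Rightarrow> 'a poly \<Rightarrow> 'a" where
  "sigma2 F G = coeff (sym_poly F G) 1"

definition spec3 :: "('a::field \<Rightarrow> real) \<Rightarrow> ('a \<Rightarrow> 'k::field_gcd) \<Rightarrow> 'a \<times> 'a \<times> 'a \<Rightarrow> 'k \<times> 'k \<times> 'k" where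
  "spec3 nv red v = (let (x, y, z) = v; S = {x, y, z};
      t = (SOME t. t \<in> S \<and> (\<forall>s\<in>S. nv s \<le> nv t))
    in (red (x / t), red (y / t), red (z / t)))"

definition proj_eq :: "'k::field_gcd \<times> 'k \<times> 'k \<Rightarrow> 'k \<times> 'k \<times> 'k \<Rightarrow> bool" where
  "proj_eq u v \<longleftrightarrow> (\<exists>\<mu>. \<mu> \<noteq> 0 \<and> fst u = \<mu> * fst v \<and> fst (snd u) = \<mu> * fst (snd v)
                       \<and> snd (snd u) = \<mu> * snd (snd v))"

definition s_red :: "('a::field \<Rightarrow> real) \<Rightarrow> ('a \<Rightarrow> 'k::field_gcd) \<Rightarrow> 'a poly \<Rightarrow> 'a poly \<Rightarrow> 'k \<times> 'k \<times> 'k" where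
  "s_red nv red F G = spec3 nv red (sigma1 F G, sigma2 F G, 1)"

text \<open>Direction at zeta_{D(a,|c|)} containing a classical point (identified with P^1(k) via gamma).\<close>
definition dir_cl :: "('a::field \<Rightarrow> real) \<Rightarrow> ('a \<Rightarrow> 'k::field_gcd) \<Rightarrow> 'a \<Rightarrow> 'a \<Rightarrow> 'a option \<Rightarrow> 'k option" where
  "dir_cl nv red a c \<alpha> = (case \<alpha> of None \<Rightarrow> None
      | Some x \<Rightarrow> (if nv ((x - a) / c) \<le> 1 then Some (red ((x - a) / c)) else None))"

text \<open>Direction at zeta_{D(a,|c|)} containing a different type II point zeta_{D(b,|d|)}.\<close>
definition dir_II :: "('a::field \<Rightarrow> real) \<Rightarrow> ('a \<Rightarrow> 'k::field_gcd) \<Rightarrow> 'a \<Rightarrow> 'a \<Rightarrow> 'a \<Rightarrow> 'a \<Rightarrow> 'k option" where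
  "dir_II nv red a c b d = (if nv d < nv c \<and> nv (b - a) \<le> nv c then Some (red ((b - a) / c)) else None)"

definition fix_dirs :: "('a::field \<Rightarrow> real) \<Rightarrow> ('a \<Rightarrow> 'k::field_gcd) \<Rightarrow> 'a poly \<Rightarrow> 'a poly \<Rightarrow> 'a \<Rightarrow> 'a \<Rightarrow> 'k option set" where
  "fix_dirs nv red F G a c = {dir_cl nv red a c \<alpha> | \<alpha>. is_fixed F G \<alpha>}"

definition branch_fix :: "('a::field \<Rightarrow> real) \<Rightarrow> ('a \<Rightarrow> 'k::field_gcd) \<Rightarrow> 'a poly \<Rightarrow> 'a poly \<Rightarrow> 'a \<Rightarrow> 'a \<Rightarrow> bool" where
  "branch_fix nv red F G a c \<longleftrightarrow> card (fix_dirs nv red F G a c) \<ge> 3"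

definition in_fix_tree :: "('a::field \<Rightarrow> real) \<Rightarrow> ('a \<Rightarrow> 'k::field_gcd) \<Rightarrow> 'a poly \<Rightarrow> 'a poly \<Rightarrow> 'a \<Rightarrow> 'a \<Rightarrow> bool" where
  "in_fix_tree nv red F G a c \<longleftrightarrow> card (fix_dirs nv red F G a c) \<ge> 2"

definition N_moved :: "('a::field \<Rightarrow> real) \<Rightarrow> ('a \<Rightarrow> 'k::field_gcd) \<Rightarrow> 'a poly \<Rightarrow> 'a poly \<Rightarrow> 'a \<Rightarrow> 'a \<Rightarrow> nat" where
  "N_moved nv red F G a c =
     card {\<delta> \<in> fix_dirs nv red F G a c. eval_red (psi_red nv red F G a c) \<delta> \<noteq> \<delta>}"

definition repelling_II :: "('a::field \<Rightarrow> real) \<Rightarrow> ('a \<Rightarrow> 'k::field_gcd) \<Rightarrow> 'a poly \<Rightarrow> 'a poly \<Rightarrow> 'a \<Rightarrow> 'a \<Rightarrow> bool" where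
  "repelling_II nv red F G b d \<longleftrightarrow> d \<noteq> 0 \<and> deg_red nv red F G b d \<ge> 2"

definition rep_dirs :: "('a::field \<Rightarrow> real) \<Rightarrow> ('a \<Rightarrow> 'k::field_gcd) \<Rightarrow> 'a poly \<Rightarrow> 'a poly \<Rightarrow> 'a \<Rightarrow> 'a \<Rightarrow> 'k option set" where
  "rep_dirs nv red F G a c = fix_dirs nv red F G a c \<union>
     {dir_II nv red a c b d | b d. repelling_II nv red F G b d \<and> \<not> same_point nv a c b d}"

definition valence :: "('a::field \<Rightarrow> real) \<Rightarrow> ('a \<Rightarrow> 'k::field_gcd) \<Rightarrow> 'a poly \<Rightarrow> 'a poly \<Rightarrow> 'a \<Rightarrow> 'a \<Rightarrow> nat" where
  "valence nv red F G a c =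
     (if repelling_II nv red F G a c \<or> card (rep_dirs nv red F G a c) \<ge> 2
      then card (rep_dirs nv red F G a c) else 0)"

definition weight :: "('a::field \<Rightarrow> real) \<Rightarrow> ('a \<Rightarrow> 'k::field_gcd) \<Rightarrow> 'a poly \<Rightarrow> 'a poly \<Rightarrow> 'a \<Rightarrow> 'a \<Rightarrow> int" where
  "weight nv red F G a c =
     (if fixed_II nv red F G a c
      then int (deg_red nv red F G a c) - 1 + int (N_moved nv red F G a c)
      else if branch_fix nv red F G a c then int (valence nv red F G a c) - 2 else 0)"

definition mob_k :: "'k::field_gcd \<Rightarrow> 'k \<Rightarrow> 'k \<Rightarrow> 'k \<Rightarrow> 'k option \<Rightarrow> 'k option" where
  "mob_k p q r s z = (case z of
      Some x \<Rightarrow> (if r * x + s = 0 then None else Some ((p * x + q) / (r * x + s)))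
    | None \<Rightarrow> (if r = 0 then None else Some (p / r)))"

definition conj_red_to :: "('a::field \<Rightarrow> real) \<Rightarrow> ('a \<Rightarrow> 'k::field_gcd) \<Rightarrow> 'a poly \<Rightarrow> 'a poly \<Rightarrow> 'a \<Rightarrow> 'a \<Rightarrow> ('k option \<Rightarrow> 'k option) \<Rightarrow> bool" where
  "conj_red_to nv red F G a c L \<longleftrightarrow> (\<exists>p q r s. p * s - q * r \<noteq> 0 \<and>
     (\<forall>z. eval_red (psi_red nv red F G a c) (mob_k p q r s z) = mob_k p q r s (L z)))"

definition W1 where
  "W1 nv red F G a c \<longleftrightarrow> fixed_II nv red F G a c \<and> deg_red nv red F G a c \<ge> 2"

definition W2 where
  "W2 nv red F G a c \<longleftrightarrow> fixed_II nv red F G a c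
     \<and> (\<exists>t. t \<noteq> 0 \<and> t \<noteq> 1 \<and> conj_red_to nv red F G a c (map_option (\<lambda>x. t * x)))
     \<and> branch_fix nv red F G a c"

definition W3 where
  "W3 nv red F G a c \<longleftrightarrow> fixed_II nv red F G a c
     \<and> (\<exists>t. t \<noteq> 0 \<and> conj_red_to nv red F G a c (map_option (\<lambda>x. x + t)))
     \<and> in_fix_tree nv red F G a c"

definition W4 where
  "W4 nv red F G a c \<longleftrightarrow> branch_fix nv red F G a c \<and> \<not> fixed_II nv red F G a c"

end

(* Over the valuation ring, give each fixed point alpha_i primitive projective coordinates
   (u_i, v_i) relative to the disc D(a,|c|), so that z G - F = l * prod (v_i z - u_i) for a
   normalized lift of the conjugated map.  With Q_i the eigenvalue of (F, G) at (u_i, v_i) and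
   D_i = l (u_i v_j - u_j v_i) (u_i v_k - u_k v_i), the multiplier is lambda_i = 1 - D_i / Q_i.
   Clearing denominators, the point [sigma_1 : sigma_2 : 1] has integral coordinates that are
   polynomials in the Q_i and D_i, so its specialization is read off from the reduced map:
   if the reduction has degree 2 then all Q_i are units; if it has degree 1 and moves the
   direction of alpha_3 then only Q_3 reduces to 0, while D_3 is a unit; if it is constant and the
   directions are distinct then two of the Q_i reduce to 0 and the third one to D_i.  The relation
   sum 1 / (1 - lambda_i) = 1 persists in the reduction and gives the remaining identities.
   That W2 or W3 fails where it should follows by counting: a map conjugate to z -> t z with
   t distinct from 0 and 1 fixes exactly two directions, a nontrivial translation exactly one. *)

theory Submission
  imports Defs
begin

section \<open>Binary forms and points of the projective line\<close>


text \<open>The four target loci for the specialized point are pairwise disjoint, so no converse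
  needs its own argument: for each degree of the reduction the point is computed, W1 to W4 are
  decided, and all equivalences are read off in both directions. Positivity of the weight is what
  supplies the starting data: in degree 1 a moved fixed direction, in degree 0 a branch point. The
  obstacle is degeneration. Fixed points may lie at infinity or coincide, distinct ones may share a
  direction, and multipliers may be non-integral, so neither the quotients \<open>D_i / Q_i\<close>
  nor affine coordinates survive reduction in general. Hence points are given by pairs of
  coordinates and maps by binary forms; identities are stated without denominators, and division
  happens only over k, once the divisor is known to be nonzero.\<close>

text \<open>The value at \<open>(x, y)\<close> of the binary form of degree \<open>n\<close> dehomogenized to \<open>f\<close>;
  only meaningful when the degree of \<open>f\<close> is at most \<open>n\<close>.\<close>
definition form_eval :: "nat \<Rightarrow> 'a::field poly \<Rightarrow> 'a \<Rightarrow> 'a \<Rightarrow> 'a" where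
  "form_eval n f x y = (if y = 0 then coeff f n * x ^ n else y ^ n * poly f (x / y))"

lemma form_eval_diff: "form_eval n (f - g) x y = form_eval n f x y - form_eval n g x y"
  by (simp add: form_eval_def algebra_simps)

lemma form_eval_smult: "form_eval n (smult a f) x y = a * form_eval n f x y"
  by (simp add: form_eval_def)

lemma coeff_mult_at_degree_bound:
  assumes "degree f \<le> m" "degree g \<le> n"
  shows "coeff (f * g) (m + n) = coeff f m * coeff g n"
proof (cases "degree f = m \<and> degree g = n")
  case True
  then show ?thesis using coeff_mult_degree_sum by metis
next
  case False
  then have "degree f + degree g < m + n" using assms by linarith
  then have "coeff (f * g) (m + n) = 0"
    by (meson coeff_eq_0 degree_mult_le le_less_trans)
  moreover have "coeff f m = 0 \<or> coeff g n = 0"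
    using False assms by (metis coeff_eq_0 order_le_less)
  ultimately show ?thesis by auto
qed

lemma form_eval_mult:
  assumes "degree f \<le> m" "degree g \<le> n"
  shows "form_eval (m + n) (f * g) x y = form_eval m f x y * form_eval n g x y"
  using coeff_mult_at_degree_bound[OF assms] by (simp add: form_eval_def power_add)

lemma form_eval_0_eq: "degree f \<le> 0 \<Longrightarrow> form_eval 0 f x y = coeff f 0"
  by (auto simp: form_eval_def elim!: degree_eq_zeroE)

lemma form_eval_linear: "form_eval 1 [:b, a:] x y = a * x + b * y"
  by (auto simp: form_eval_def field_simps)

lemma degree_le_1_E:
  assumes "degree f \<le> 1"
  obtains a b where "f = [:b, a:]"
proof
  show "f = [:coeff f 0, coeff f 1:]"
    using assms by (intro poly_eqI) (auto simp: coeff_pCons coeff_eq_0 split: nat.splits)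
qed

lemma degree_le_2_E:
  assumes "degree f \<le> 2"
  obtains a b c where "f = [:c, b, a:]"
proof
  show "f = [:coeff f 0, coeff f 1, coeff f 2:]"
    using assms
    by (intro poly_eqI) (auto simp: coeff_pCons coeff_eq_0 numeral_2_eq_2 split: nat.splits)
qed

lemma form_eval_quadratic: "form_eval 2 [:c, b, a:] x y = a * x\<^sup>2 + b * x * y + c * y\<^sup>2"
  by (auto simp: form_eval_def field_simps power2_eq_square numeral_2_eq_2)

text \<open>Coprimality excludes common finite zeros only; the condition on the coefficients at the
  formal degree excludes a common zero at infinity.\<close>

lemma form_eval_coprime:
  assumes "coprime f g" "coeff f n \<noteq> 0 \<or> coeff g n \<noteq> 0" "x \<noteq> 0 \<or> y \<noteq> 0"
  shows "form_eval n f x y \<noteq> 0 \<or> form_eval n g x y \<noteq> 0"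
proof (cases "y = 0")
  case True
  then show ?thesis using assms by (auto simp: form_eval_def)
next
  case False
  then show ?thesis
    using coprime_poly_0[OF assms(1)] by (auto simp: form_eval_def)
qed

definition proj_pt :: "'a::field \<Rightarrow> 'a \<Rightarrow> 'a option" where
  "proj_pt x y = (if y = 0 then None else Some (x / y))"

text \<open>With the representatives (1, 0) and (x, 1) infinity needs no special role:
  \<open>[:- proj_x \<alpha>, proj_y \<alpha>:]\<close> is the dehomogenized linear form vanishing
  at \<alpha>, which for infinity degenerates to the constant -1.\<close>

definition proj_x :: "'a::field option \<Rightarrow> 'a" where
  "proj_x \<delta> = (case \<delta> of None \<Rightarrow> 1 | Some x \<Rightarrow> x)"

definition proj_y :: "'a::field option \<Rightarrow> 'a" where
  "proj_y \<delta> = (case \<delta> of None \<Rightarrow> 0 | Some x \<Rightarrow> 1)"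

text \<open>The determinant of the two representatives, that is, the linear form vanishing at
  \<epsilon> evaluated at \<delta>.\<close>

definition wedge :: "'a::field option \<Rightarrow> 'a option \<Rightarrow> 'a" where
  "wedge \<delta> \<epsilon> = proj_x \<delta> * proj_y \<epsilon> - proj_x \<epsilon> * proj_y \<delta>"

lemma proj_pt_coords [simp]: "proj_pt (proj_x \<delta>) (proj_y \<delta>) = \<delta>"
  by (cases \<delta>) (simp_all add: proj_pt_def proj_x_def proj_y_def)

lemma proj_coords_nonzero: "proj_x \<delta> \<noteq> 0 \<or> proj_y \<delta> \<noteq> 0"
  by (cases \<delta>) (simp_all add: proj_x_def proj_y_def)

lemma wedge_eq_0_iff: "wedge \<delta> \<epsilon> = 0 \<longleftrightarrow> \<delta> = \<epsilon>"
  by (cases \<delta>; cases \<epsilon>) (simp_all add: wedge_def proj_x_def proj_y_def)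

lemma proj_pt_scale: "s \<noteq> 0 \<Longrightarrow> proj_pt (s * x) (s * y) = proj_pt x y"
  by (simp add: proj_pt_def)

lemma proj_pt_eq_iff:
  assumes "x \<noteq> 0 \<or> y \<noteq> 0" "x' \<noteq> 0 \<or> y' \<noteq> 0"
  shows "proj_pt x y = proj_pt x' y' \<longleftrightarrow> x * y' = x' * y"
  using assms by (auto simp: proj_pt_def field_simps)

lemma proj_pt_eq_point_iff:
  assumes "x \<noteq> 0 \<or> y \<noteq> 0"
  shows "proj_pt x y = \<delta> \<longleftrightarrow> proj_x \<delta> * y - x * proj_y \<delta> = 0"
  using proj_pt_eq_iff[OF assms proj_coords_nonzero[of \<delta>]] by auto

section \<open>Moebius transformations over the residue field and the fixed points of their normal
  forms\<close>

lemma mob_k_pt: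
  assumes "x \<noteq> 0 \<or> y \<noteq> 0"
  shows "mob_k p q r s (proj_pt x y) = proj_pt (p * x + q * y) (r * x + s * y)"
proof (cases "y = 0")
  case True
  then show ?thesis using assms by (auto simp: mob_k_def proj_pt_def)
next
  case False
  define P R where "P = p * x + q * y" and "R = r * x + s * y"
  have "r * (x / y) + s = R / y" "p * (x / y) + q = P / y"
    using False by (simp_all add: add_divide_distrib P_def R_def)
  then show ?thesis using False by (simp add: mob_k_def proj_pt_def flip: P_def R_def)
qed

lemma eval_red_pt:
  assumes "x \<noteq> 0 \<or> y \<noteq> 0"
  shows "eval_red (f, g, e) (proj_pt x y) = proj_pt (form_eval e f x y) (form_eval e g x y)"
  using assms by (auto simp: eval_red_def proj_pt_def form_eval_def)

lemma det_nonzero_image: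
  fixes p q r s x y :: "'a::field"
  assumes "p * s - q * r \<noteq> 0" "x \<noteq> 0 \<or> y \<noteq> 0"
  shows "p * x + q * y \<noteq> 0 \<or> r * x + s * y \<noteq> 0"
proof (rule ccontr)
  assume "\<not> ?thesis"
  then have "p * x + q * y = 0" "r * x + s * y = 0" by auto
  then have "(p * s - q * r) * x = 0" "(p * s - q * r) * y = 0" by algebra+
  then show False using assms by auto
qed

text \<open>The adjugate matrix gives a left inverse: the product of the two matrices is the
  determinant times the identity, and \<open>proj_pt\<close> ignores the scalar.\<close>

lemma mob_k_inj:
  fixes p q r s :: "'k::field_gcd"
  assumes "p * s - q * r \<noteq> 0" "mob_k p q r s z = mob_k p q r s w"
  shows "z = w"
proof -
  have *: "mob_k s (-q) (-r) p (mob_k p q r s z) = z" for z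
  proof -
    let ?x = "proj_x z" and ?y = "proj_y z"
    note nz = proj_coords_nonzero[of z]
    have "mob_k p q r s z = proj_pt (p * ?x + q * ?y) (r * ?x + s * ?y)"
      using mob_k_pt[OF nz, of p q r s] by (simp only: proj_pt_coords)
    then have "mob_k s (-q) (-r) p (mob_k p q r s z)
        = proj_pt (s * (p * ?x + q * ?y) + (-q) * (r * ?x + s * ?y))
             ((-r) * (p * ?x + q * ?y) + p * (r * ?x + s * ?y))"
      by (simp only: mob_k_pt[OF det_nonzero_image[OF assms(1) nz]])
    also have "\<dots> = proj_pt ((p * s - q * r) * ?x) ((p * s - q * r) * ?y)"
      by (simp add: algebra_simps)
    finally show ?thesis by (simp only: proj_pt_scale[OF assms(1)] proj_pt_coords)
  qed
  have "z = mob_k s (-q) (-r) p (mob_k p q r s z)" by (rule *[symmetric])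
  also have "\<dots> = mob_k s (-q) (-r) p (mob_k p q r s w)" by (rule arg_cong[OF assms(2)])
  also have "\<dots> = w" by (rule *)
  finally show ?thesis .
qed

lemma mob_k_surj:
  fixes p q r s :: "'k::field_gcd"
  assumes "p * s - q * r \<noteq> 0"
  obtains z where "mob_k p q r s z = w"
proof
  let ?x = "proj_x w" and ?y = "proj_y w"
  note nz = proj_coords_nonzero[of w]
  have d: "s * p - (-q) * (-r) \<noteq> 0" using assms by (simp add: algebra_simps)
  have "mob_k p q r s (proj_pt (s * ?x + (-q) * ?y) ((-r) * ?x + p * ?y)) =
    proj_pt (p * (s * ?x + (-q) * ?y) + q * ((-r) * ?x + p * ?y)) (r * (s * ?x + (-q) * ?y) + s * ((-r) * ?x + p * ?y))"
    by (rule mob_k_pt[OF det_nonzero_image[OF d nz]])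
  also have "\<dots> = proj_pt ((p * s - q * r) * ?x) ((p * s - q * r) * ?y)"
    by (simp add: algebra_simps)
  finally show "mob_k p q r s (proj_pt (s * ?x + (-q) * ?y) ((-r) * ?x + p * ?y)) = w"
    by (simp only: proj_pt_scale[OF assms] proj_pt_coords)
qed

text \<open>Fixed points are transported by the bijection \<open>mob_k\<close>, and a scaling with
  factor other than 1 fixes only 0 and infinity. Since \<psi> is an arbitrary function, the count
  applies to whatever reduction is claimed to be conjugate to a scaling.\<close>

lemma fixed_points_conj_scaling:
  fixes \<psi> :: "'k::field_gcd option \<Rightarrow> 'k option"
  assumes "p * s - q * r \<noteq> 0" "t \<noteq> 1"
    and "\<And>z. \<psi> (mob_k p q r s z) = mob_k p q r s (map_option (\<lambda>x. t * x) z)"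
  shows "{z. \<psi> z = z} = {mob_k p q r s (Some 0), mob_k p q r s None}"
    and "mob_k p q r s (Some 0) \<noteq> mob_k p q r s None"
proof -
  show "{z. \<psi> z = z} = {mob_k p q r s (Some 0), mob_k p q r s None}"
  proof (intro equalityI subsetI)
    fix z assume z: "z \<in> {z. \<psi> z = z}"
    obtain w where w: "mob_k p q r s w = z" using mob_k_surj[OF assms(1)] .
    have "mob_k p q r s (map_option (\<lambda>x. t * x) w) = \<psi> (mob_k p q r s w)"
      by (rule assms(3)[symmetric])
    also have "\<dots> = mob_k p q r s w" using z unfolding w by blast
    finally have "map_option (\<lambda>x. t * x) w = w" by (rule mob_k_inj[OF assms(1)])
    then have "w = Some 0 \<or> w = None" using \<open>t \<noteq> 1\<close> by (cases w) auto
    then show "z \<in> {mob_k p q r s (Some 0), mob_k p q r s None}" using w by auto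
  next
    have "\<psi> (mob_k p q r s (Some 0)) = mob_k p q r s (Some 0)" "\<psi> (mob_k p q r s None) = mob_k p q r s None"
      by (simp_all only: assms(3) option.map mult_zero_right)
    then show "z \<in> {z. \<psi> z = z}" if "z \<in> {mob_k p q r s (Some 0), mob_k p q r s None}" for z
      using that by blast
  qed
  show "mob_k p q r s (Some 0) \<noteq> mob_k p q r s None"
    using mob_k_inj[OF assms(1), of "Some 0" None] by auto
qed

lemma fixed_points_conj_translation:
  fixes \<psi> :: "'k::field_gcd option \<Rightarrow> 'k option"
  assumes "p * s - q * r \<noteq> 0" "t \<noteq> 0"
    and "\<And>z. \<psi> (mob_k p q r s z) = mob_k p q r s (map_option (\<lambda>x. x + t) z)"
  shows "{z. \<psi> z = z} = {mob_k p q r s None}"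
proof (intro equalityI subsetI)
  fix z assume z: "z \<in> {z. \<psi> z = z}"
  obtain w where w: "mob_k p q r s w = z" using mob_k_surj[OF assms(1)] .
  have "mob_k p q r s (map_option (\<lambda>x. x + t) w) = \<psi> (mob_k p q r s w)"
    by (rule assms(3)[symmetric])
  also have "\<dots> = mob_k p q r s w" using z unfolding w by blast
  finally have "map_option (\<lambda>x. x + t) w = w" by (rule mob_k_inj[OF assms(1)])
  then have "w = None" using \<open>t \<noteq> 0\<close> by (cases w) auto
  then show "z \<in> {mob_k p q r s None}" using w by auto
next
  have "\<psi> (mob_k p q r s None) = mob_k p q r s None"
    by (simp only: assms(3) option.map)
  then show "z \<in> {z. \<psi> z = z}" if "z \<in> {mob_k p q r s None}" for z
    using that by blast
qed

text \<open>The polynomial gcd misses a common zero at infinity; its order is the term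
  \<open>min (2 - degree f) (2 - degree g)\<close> in \<open>cancel_pair\<close>. The full common
  factor is therefore a form of degree \<open>2 - e\<close>, which may exceed the degree of
  \<open>gcd f g\<close>.\<close>

lemma cancel_pair_props:
  fixes f g f0 g0 :: "'k::field_gcd poly"
  assumes "degree f \<le> 2" "degree g \<le> 2" "f \<noteq> 0 \<or> g \<noteq> 0" "cancel_pair (f, g) = (f0, g0, e)"
  shows "f = gcd f g * f0" "g = gcd f g * g0" "gcd f g \<noteq> 0" "e \<le> 2" "degree (gcd f g) \<le> 2 - e"
    "degree f0 \<le> e" "degree g0 \<le> e" "coprime f0 g0" "coeff f0 e \<noteq> 0 \<or> coeff g0 e \<noteq> 0"
proof -
  define h where "h = gcd f g"
  have f0: "f0 = f div h" and g0: "g0 = g div h"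
    and e: "e = 2 - degree h - min (2 - degree f) (2 - degree g)"
    using assms(4) by (auto simp: cancel_pair_def h_def Let_def)
  show f: "f = gcd f g * f0" and g: "g = gcd f g * g0" by (simp_all add: f0 g0 h_def)
  show h: "gcd f g \<noteq> 0" using assms(3) by auto
  show "e \<le> 2" by (simp add: e)
  have df: "f0 = 0 \<or> degree f = degree h + degree f0"
    using f h by (metis h_def degree_mult_eq)
  have dg: "g0 = 0 \<or> degree g = degree h + degree g0"
    using g h by (metis h_def degree_mult_eq)
  have f0z: "f0 = 0 \<Longrightarrow> degree f = 0" and g0z: "g0 = 0 \<Longrightarrow> degree g = 0"
    using f g by (metis degree_0 mult_zero_right)+
  have nz: "f0 \<noteq> 0 \<or> g0 \<noteq> 0" using assms(3) f g by (metis mult_zero_right)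
  \<comment> \<open>Two minus the smaller codegree is the larger degree; a zero polynomial has
    degree 0 and does not disturb the maximum.\<close>
  have e': "e + degree h = max (degree f) (degree g)"
    using e df dg f0z g0z nz assms(1,2) by linarith
  show "degree (gcd f g) \<le> 2 - e" using e' assms(1,2) unfolding h_def by linarith
  show "degree f0 \<le> e" using e' df by (cases "f0 = 0") auto
  show "degree g0 \<le> e" using e' dg by (cases "g0 = 0") auto
  show "coprime f0 g0" using assms(3) by (simp add: f0 g0 h_def div_gcd_coprime)
  have "(f0 \<noteq> 0 \<and> degree f0 = e) \<or> (g0 \<noteq> 0 \<and> degree g0 = e)"
    using e' df dg f0z g0z nz by (cases "f0 = 0"; cases "g0 = 0") (auto simp: max_def split: if_splits)
  then show "coeff f0 e \<noteq> 0 \<or> coeff g0 e \<noteq> 0" by auto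
qed

section \<open>Quadratic maps over the residue field\<close>


text \<open>What remains of the map over k alone. The three directions may coincide, the eigenvalues
  may vanish, and \<open>l\<close> is 0 exactly when the cancelled map is the identity.\<close>

locale reduced_quadratic =
  fixes f g f0 g0 :: "'k::field_gcd poly" and e :: nat and l :: 'k
    and \<delta>1 \<delta>2 \<delta>3 :: "'k option" and Q1 Q2 Q3 :: 'k
  assumes degs: "degree f \<le> 2" "degree g \<le> 2" and nonzero: "f \<noteq> 0 \<or> g \<noteq> 0"
    and cancel: "cancel_pair (f, g) = (f0, g0, e)"
    and fixed_form: "[:0, 1:] * g - f =
      smult l ([:- proj_x \<delta>1, proj_y \<delta>1:] * ([:- proj_x \<delta>2, proj_y \<delta>2:] * [:- proj_x \<delta>3, proj_y \<delta>3:]))"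
    and eigen1: "form_eval 2 f (proj_x \<delta>1) (proj_y \<delta>1) = Q1 * proj_x \<delta>1" "form_eval 2 g (proj_x \<delta>1) (proj_y \<delta>1) = Q1 * proj_y \<delta>1"
    and eigen2: "form_eval 2 f (proj_x \<delta>2) (proj_y \<delta>2) = Q2 * proj_x \<delta>2" "form_eval 2 g (proj_x \<delta>2) (proj_y \<delta>2) = Q2 * proj_y \<delta>2"
    and eigen3: "form_eval 2 f (proj_x \<delta>3) (proj_y \<delta>3) = Q3 * proj_x \<delta>3" "form_eval 2 g (proj_x \<delta>3) (proj_y \<delta>3) = Q3 * proj_y \<delta>3"
begin

text \<open>\<open>h\<close> is the common factor with its zeros at infinity included,
  \<open>q\<close> is the fixed point form of the cancelled map.\<close>

abbreviation "h \<equiv> form_eval (2 - e) (gcd f g)"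
abbreviation "q x y \<equiv> x * form_eval e g0 x y - y * form_eval e f0 x y"
abbreviation "\<psi> \<equiv> eval_red (f0, g0, e)"

text \<open>The fixed point form without its i-th linear factor, evaluated at the i-th direction: a
  homogeneous substitute for the derivative at that root.\<close>

definition "D1 = l * wedge \<delta>1 \<delta>2 * wedge \<delta>1 \<delta>3"
definition "D2 = l * wedge \<delta>2 \<delta>1 * wedge \<delta>2 \<delta>3"
definition "D3 = l * wedge \<delta>3 \<delta>1 * wedge \<delta>3 \<delta>2"

lemmas factor = cancel_pair_props[OF degs nonzero cancel]

lemma form_eval_f: "form_eval 2 f x y = h x y * form_eval e f0 x y"
  and form_eval_g: "form_eval 2 g x y = h x y * form_eval e g0 x y"
  using form_eval_mult[OF factor(5,6), of x y] form_eval_mult[OF factor(5,7), of x y] factor(1,2,4) by simp_all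

lemma base_point_free: "x \<noteq> 0 \<or> y \<noteq> 0 \<Longrightarrow> form_eval e f0 x y \<noteq> 0 \<or> form_eval e g0 x y \<noteq> 0"
  by (rule form_eval_coprime[OF factor(8,9)])

lemma fixed_iff: "\<psi> \<delta> = \<delta> \<longleftrightarrow> q (proj_x \<delta>) (proj_y \<delta>) = 0"
  using eval_red_pt[OF proj_coords_nonzero[of \<delta>], of f0 g0 e]
    proj_pt_eq_point_iff[OF base_point_free[OF proj_coords_nonzero[of \<delta>]], of \<delta>]
  by (simp add: mult.commute)

text \<open>Two factorizations of the cubic form x g - y f: by the common factor, and by the three
  fixed directions.\<close>

lemma h_q: "h x y * q x y =
  l * (proj_y \<delta>1 * x - proj_x \<delta>1 * y) * (proj_y \<delta>2 * x - proj_x \<delta>2 * y) * (proj_y \<delta>3 * x - proj_x \<delta>3 * y)"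
proof -
  have lin: "degree [:a, b:] \<le> 1" for a b :: 'k by simp
  have lin2: "degree ([:a, b:] * [:c, d:]) \<le> 2" for a b c d :: 'k
    using degree_mult_le[of "[:a, b:]" "[:c, d:]"] lin[of a b] lin[of c d] by linarith
  have three: "(3::nat) = 1 + 2" "(2::nat) = 1 + 1" by simp_all
  have "form_eval 3 ([:0, 1:] * g - f) x y = x * form_eval 2 g x y - y * form_eval 2 f x y"
  proof -
    have "form_eval 3 ([:0, 1:] * g) x y = x * form_eval 2 g x y"
      unfolding three(1) using form_eval_mult[OF lin degs(2), of 0 1 x y] by (simp only: form_eval_linear) simp
    \<comment> \<open>Read as a linear form, the constant polynomial \<open>[:1, 0:]\<close> is y;
      this raises the formal degree of f from 2 to 3.\<close>
    moreover have "form_eval 3 ([:1, 0:] * f) x y = y * form_eval 2 f x y"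
      unfolding three(1) using form_eval_mult[OF lin degs(1), of 1 0 x y] by (simp only: form_eval_linear) simp
    ultimately show ?thesis by (simp add: form_eval_diff)
  qed
  moreover have "form_eval 3 ([:- proj_x \<delta>1, proj_y \<delta>1:] * ([:- proj_x \<delta>2, proj_y \<delta>2:] * [:- proj_x \<delta>3, proj_y \<delta>3:])) x y
      = (proj_y \<delta>1 * x - proj_x \<delta>1 * y) * ((proj_y \<delta>2 * x - proj_x \<delta>2 * y) * (proj_y \<delta>3 * x - proj_x \<delta>3 * y))"
    unfolding three(1) form_eval_mult[OF lin lin2] unfolding three(2) form_eval_mult[OF lin lin] form_eval_linear by simp
  ultimately have "x * form_eval 2 g x y - y * form_eval 2 f x y
      = l * ((proj_y \<delta>1 * x - proj_x \<delta>1 * y) * ((proj_y \<delta>2 * x - proj_x \<delta>2 * y) * (proj_y \<delta>3 * x - proj_x \<delta>3 * y)))"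
    by (simp only: fixed_form form_eval_smult)
  moreover have "h x y * q x y = x * form_eval 2 g x y - y * form_eval 2 f x y"
    unfolding form_eval_f form_eval_g by (simp only: mult.left_commute right_diff_distrib)
  ultimately show ?thesis by (simp only: mult.assoc)
qed

text \<open>The eigenvalue is 0 iff both forms vanish at the point; as the cancelled pair has no
  base points, this can come only from \<open>h\<close>.\<close>

lemma eigen_0_iff:
  assumes "form_eval 2 f (proj_x \<delta>) (proj_y \<delta>) = Q * proj_x \<delta>" "form_eval 2 g (proj_x \<delta>) (proj_y \<delta>) = Q * proj_y \<delta>"
  shows "Q = 0 \<longleftrightarrow> h (proj_x \<delta>) (proj_y \<delta>) = 0"
  using assms proj_coords_nonzero[of \<delta>] base_point_free[OF proj_coords_nonzero[of \<delta>]]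
  by (auto simp: form_eval_f form_eval_g)

text \<open>Away from the zeros of \<open>h\<close> the cancelled map agrees with the pair (f, g),
  for which the point is an eigenvector. Contrapositively, the eigenvalue at a moved direction is
  0.\<close>

lemma eigen_fixed:
  assumes "form_eval 2 f (proj_x \<delta>) (proj_y \<delta>) = Q * proj_x \<delta>" "form_eval 2 g (proj_x \<delta>) (proj_y \<delta>) = Q * proj_y \<delta>" "Q \<noteq> 0"
  shows "\<psi> \<delta> = \<delta>"
proof -
  have "h (proj_x \<delta>) (proj_y \<delta>) * q (proj_x \<delta>) (proj_y \<delta>) = proj_x \<delta> * (Q * proj_y \<delta>) - proj_y \<delta> * (Q * proj_x \<delta>)"
    using assms(1,2) by (simp add: form_eval_f form_eval_g algebra_simps)
  then have "h (proj_x \<delta>) (proj_y \<delta>) * q (proj_x \<delta>) (proj_y \<delta>) = 0" by simp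
  then show ?thesis using assms eigen_0_iff unfolding fixed_iff by auto
qed

lemmas eigens = eigen_0_iff[OF eigen1] eigen_0_iff[OF eigen2] eigen_0_iff[OF eigen3]
  eigen_fixed[OF eigen1] eigen_fixed[OF eigen2] eigen_fixed[OF eigen3]

text \<open>The identity \<open>(\<Sum>i. 1 / (1 - \<lambda>\<^sub>i)) = 1\<close> with \<open>1 - \<lambda>\<^sub>i = D\<^sub>i / Q\<^sub>i\<close>, cleared of
  denominators so that it survives when some of them vanish.\<close>
lemma holomorphic_fixed_point_formula:
  "Q1 * D2 * D3 + Q2 * D1 * D3 + Q3 * D1 * D2 = D1 * D2 * D3"
proof -
  obtain a0 a1 a2 where f: "f = [:a2, a1, a0:]" using degs(1) degree_le_2_E by blast
  obtain b0 b1 b2 where g: "g = [:b2, b1, b0:]" using degs(2) degree_le_2_E by blast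
  have Q_eq: "Q = (case \<delta> of None \<Rightarrow> a0 | Some u \<Rightarrow> b0 * u\<^sup>2 + b1 * u + b2)"
    if "form_eval 2 f (proj_x \<delta>) (proj_y \<delta>) = Q * proj_x \<delta>" "form_eval 2 g (proj_x \<delta>) (proj_y \<delta>) = Q * proj_y \<delta>" for \<delta> Q
    using that by (cases \<delta>) (simp_all add: f g form_eval_quadratic proj_x_def proj_y_def)
  have b: "b0 = l * (proj_y \<delta>1 * proj_y \<delta>2 * proj_y \<delta>3)"
    "b1 = a0 - l * (proj_x \<delta>1 * proj_y \<delta>2 * proj_y \<delta>3 + proj_y \<delta>1 * proj_x \<delta>2 * proj_y \<delta>3 + proj_y \<delta>1 * proj_y \<delta>2 * proj_x \<delta>3)"
    using fixed_form unfolding f g by (simp_all add: algebra_simps)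
  \<comment> \<open>For three finite directions this is Lagrange interpolation: the sum of g(u_i) /
    prod (u_i - u_j) is the leading coefficient of g, which equals l. Cleared of denominators it is
    a polynomial identity, so coinciding directions are allowed.\<close>
  show ?thesis
    unfolding Q_eq[OF eigen1] Q_eq[OF eigen2] Q_eq[OF eigen3] b D1_def D2_def D3_def wedge_def
    by (cases \<delta>1; cases \<delta>2; cases \<delta>3)
      (simp_all add: proj_x_def proj_y_def power2_eq_square algebra_simps)
qed

text \<open>In degree 2 nothing cancels, so \<open>h\<close> is a nonzero constant and has no
  zeros.\<close>

lemma good_reduction:
  assumes "e = 2"
  shows "Q1 \<noteq> 0" "Q2 \<noteq> 0" "Q3 \<noteq> 0" "\<psi> \<delta>1 = \<delta>1" "\<psi> \<delta>2 = \<delta>2" "\<psi> \<delta>3 = \<delta>3"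
proof -
  have "degree (gcd f g) = 0" using factor(5) assms by simp
  then have "h x y \<noteq> 0" for x y
    using factor(3) assms form_eval_0_eq[of "gcd f g" x y] by (auto elim!: degree_eq_zeroE)
  then show "Q1 \<noteq> 0" "Q2 \<noteq> 0" "Q3 \<noteq> 0" "\<psi> \<delta>1 = \<delta>1" "\<psi> \<delta>2 = \<delta>2" "\<psi> \<delta>3 = \<delta>3"
    using eigens by blast+
qed

text \<open>If the fixed point form vanished, the cancelled map would be the identity, which is not
  constant.\<close>

lemma fixed_form_nonzero: "e = 0 \<Longrightarrow> l \<noteq> 0"
proof
  assume e: "e = 0" and l: "l = 0"
  have d: "f0 = [:coeff f0 0:]" "g0 = [:coeff g0 0:]" using factor(6,7) e
    by (simp_all add: degree_0_id)
  have "gcd f g * ([:0, 1:] * g0 - f0) = [:0, 1:] * g - f"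
    using factor(1,2) by (simp add: algebra_simps)
  also have "\<dots> = 0" using fixed_form l by simp
  finally have "[:0, 1:] * g0 - f0 = 0" using factor(3) by (simp only: mult_eq_0_iff simp_thms)
  moreover have "[:0, 1:] * g0 - f0 = [:- coeff f0 0, coeff g0 0:]" by (subst d(1), subst d(2)) simp
  ultimately show False using factor(9) e by simp
qed

text \<open>A constant map fixes a single direction, so at least two eigenvalues vanish. The fixed
  point formula then has one term left on its left side, and cancelling two of the nonzero
  \<open>D\<close>'s gives the third eigenvalue.\<close>

lemma constant_reduction:
  assumes "e = 0" and dist: "\<delta>1 \<noteq> \<delta>2" "\<delta>1 \<noteq> \<delta>3" "\<delta>2 \<noteq> \<delta>3"
  shows "D1 \<noteq> 0" "D2 \<noteq> 0" "D3 \<noteq> 0"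
    and "(Q1 = 0 \<and> Q2 = 0 \<and> Q3 = D3) \<or> (Q1 = 0 \<and> Q3 = 0 \<and> Q2 = D2) \<or> (Q2 = 0 \<and> Q3 = 0 \<and> Q1 = D1)"
proof -
  show D: "D1 \<noteq> 0" "D2 \<noteq> 0" "D3 \<noteq> 0"
    using dist fixed_form_nonzero[OF assms(1)] by (auto simp: D1_def D2_def D3_def wedge_eq_0_iff)
  have *: "\<delta> = \<epsilon>" if "\<psi> \<delta> = \<delta>" "\<psi> \<epsilon> = \<epsilon>" for \<delta> \<epsilon>
  proof -
    have "form_eval e f0 x y = coeff f0 0" "form_eval e g0 x y = coeff g0 0" for x y
      using factor(6,7) assms(1) form_eval_0_eq by auto
    then show ?thesis
      using that eval_red_pt[OF proj_coords_nonzero[of \<delta>], of f0 g0 e] eval_red_pt[OF proj_coords_nonzero[of \<epsilon>], of f0 g0 e]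
      by simp
  qed
  have "Q1 = 0 \<or> Q2 = 0" "Q1 = 0 \<or> Q3 = 0" "Q2 = 0 \<or> Q3 = 0"
    using eigens(4-6) * dist by metis+
  then show "(Q1 = 0 \<and> Q2 = 0 \<and> Q3 = D3) \<or> (Q1 = 0 \<and> Q3 = 0 \<and> Q2 = D2) \<or> (Q2 = 0 \<and> Q3 = 0 \<and> Q1 = D1)"
    using holomorphic_fixed_point_formula D by auto
qed

end


section \<open>Reduction of degree one: location of the base point and normal forms of the cancelled
  map\<close>

lemma proj_pt_eq_E:
  fixes x y :: "'a::field"
  assumes "x \<noteq> 0 \<or> y \<noteq> 0" "proj_pt x y = \<delta>"
  obtains s where "s \<noteq> 0" "x = s * proj_x \<delta>" "y = s * proj_y \<delta>"
  using assms by (cases "y = 0") (auto simp: proj_pt_def proj_x_def proj_y_def)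

lemma map_option_mult_pt:
  fixes x y s t :: "'a::field"
  assumes "s \<noteq> 0"
  shows "map_option (\<lambda>u. t / s * u) (proj_pt x y) = proj_pt (t * x) (s * y)"
  using assms by (simp add: proj_pt_def)

lemma map_option_add_pt:
  fixes x y s t :: "'a::field"
  assumes "s \<noteq> 0"
  shows "map_option (\<lambda>u. u + t / s) (proj_pt x y) = proj_pt (s * x + t * y) (s * y)"
  using assms by (simp add: proj_pt_def add_divide_distrib)

text \<open>The moved direction receives index 3 by convention; permuting the fixed points achieves
  this. Its existence rules out the identity as cancelled map.\<close>

locale linear_reduction = reduced_quadratic +
  assumes e: "e = 1" and moved: "\<psi> \<delta>3 \<noteq> \<delta>3"
begin

lemma moved_root: "Q3 = 0" "h (proj_x \<delta>3) (proj_y \<delta>3) = 0"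
  using eigens(3,6) moved by blast+

lemma gcd_linear: obtains h0 h1 where "gcd f g = [:h0, h1:]" "h0 \<noteq> 0 \<or> h1 \<noteq> 0"
    "\<forall>x y. h x y = h1 * x + h0 * y"
proof -
  have "degree (gcd f g) \<le> 1" using factor(5) e by simp
  then obtain h0 h1 where "gcd f g = [:h0, h1:]" using degree_le_1_E by blast
  then show thesis using that factor(3) e form_eval_linear[of h0 h1] by auto
qed

lemma reduced_linear: obtains A B C D where "f0 = [:B, A:]" "g0 = [:D, C:]"
    "\<forall>x y. form_eval e f0 x y = A * x + B * y" "\<forall>x y. form_eval e g0 x y = C * x + D * y"
proof -
  have "degree f0 \<le> 1" "degree g0 \<le> 1" using factor(6,7) e by simp_all
  then obtain A B C D where "f0 = [:B, A:]" "g0 = [:D, C:]" using degree_le_1_E by metis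
  then show thesis using that e form_eval_linear[of B A] form_eval_linear[of D C] by auto
qed

text \<open>\<open>D3\<close> is the derivative at the third root of the fixed point form, which factors as
  \<open>h * q\<close> with \<open>h\<close> vanishing and \<open>q\<close> not vanishing there.\<close>
lemma simple_moved_root: "D3 \<noteq> 0"
proof -
  obtain h0 h1 where h: "gcd f g = [:h0, h1:]" "h0 \<noteq> 0 \<or> h1 \<noteq> 0" "\<forall>x y. h x y = h1 * x + h0 * y"
    using gcd_linear .
  obtain A B C D where A: "f0 = [:B, A:]" "g0 = [:D, C:]"
    "\<forall>x y. form_eval e f0 x y = A * x + B * y" "\<forall>x y. form_eval e g0 x y = C * x + D * y"
    using reduced_linear .
  have "[:h0, h1:] * ([:0, 1:] * [:D, C:] - [:B, A:]) = [:0, 1:] * g - f"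
    using factor(1,2) unfolding A h by (simp add: algebra_simps)
  then have eq: "[:h0, h1:] * ([:0, 1:] * [:D, C:] - [:B, A:]) =
      smult l ([:- proj_x \<delta>1, proj_y \<delta>1:] * ([:- proj_x \<delta>2, proj_y \<delta>2:] * [:- proj_x \<delta>3, proj_y \<delta>3:]))"
    using fixed_form by simp
  have q: "q (proj_x \<delta>3) (proj_y \<delta>3) \<noteq> 0" using moved fixed_iff by simp
  show ?thesis
  proof (cases \<delta>3)
    case None
    then have "h1 = 0" using moved_root h(3) by (simp add: proj_x_def proj_y_def)
    then have "D3 = - (h0 * C)"
      unfolding D3_def wedge_def using eq None by (simp add: proj_x_def proj_y_def algebra_simps)
    then show ?thesis using q None h(2) \<open>h1 = 0\<close> by (simp add: A(3,4) proj_x_def proj_y_def)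
  next
    case (Some u)
    then have h0: "h0 = - h1 * u" using moved_root h(3) by (simp add: proj_x_def proj_y_def add_eq_0_iff2)
    \<comment> \<open>Both cubics are divisible by z - u, so their three top coefficients determine
      the quadratic quotients, which are then compared at u.\<close>
    let ?x1 = "proj_x \<delta>1" and ?x2 = "proj_x \<delta>2" and ?y1 = "proj_y \<delta>1" and ?y2 = "proj_y \<delta>2"
    have c: "h1 * C = l * (?y1 * ?y2)"
      "h0 * C + h1 * (D - A) = - (l * (?y1 * ?y2 * u + ?x1 * ?y2 + ?y1 * ?x2))"
      "h0 * (D - A) - h1 * B = l * (?x1 * ?y2 * u + ?y1 * ?x2 * u + ?x1 * ?x2)"
      using eq Some by (simp_all add: proj_x_def proj_y_def algebra_simps)
    have u: "proj_x \<delta>3 = u" "proj_y \<delta>3 = 1" using Some by (simp_all add: proj_x_def proj_y_def)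
    have "D3 = l * ((u * ?y1 - ?x1) * (u * ?y2 - ?x2))"
      unfolding D3_def wedge_def u by (simp add: mult.assoc)
    also have "\<dots> = h1 * (u * (C * u + D) - (A * u + B))"
      using c unfolding h0 by algebra
    finally show ?thesis using q h(2) h0 unfolding u by (auto simp: A(3,4))
  qed
qed

lemma l_nonzero: "l \<noteq> 0"
  and moved_root_distinct: "\<delta>1 \<noteq> \<delta>3" "\<delta>2 \<noteq> \<delta>3"
  using simple_moved_root by (auto simp: D3_def wedge_eq_0_iff)

text \<open>The common factor is a nonzero linear form, so the moved direction is its only
  zero.\<close>

lemma Q_nonzero: "Q1 \<noteq> 0" "Q2 \<noteq> 0"
proof -
  obtain h0 h1 where h: "gcd f g = [:h0, h1:]" "h0 \<noteq> 0 \<or> h1 \<noteq> 0" "\<forall>x y. h x y = h1 * x + h0 * y"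
    using gcd_linear .
  have "h (proj_x \<epsilon>) (proj_y \<epsilon>) \<noteq> 0" if "\<epsilon> \<noteq> \<delta>3" for \<epsilon>
  proof
    assume "h (proj_x \<epsilon>) (proj_y \<epsilon>) = 0"
    then have "h1 * proj_x \<epsilon> + h0 * proj_y \<epsilon> = 0" "h1 * proj_x \<delta>3 + h0 * proj_y \<delta>3 = 0"
      using moved_root(2) by (simp_all only: h(3))
    then have "h1 * wedge \<epsilon> \<delta>3 = 0" "h0 * wedge \<epsilon> \<delta>3 = 0"
      unfolding wedge_def by algebra+
    then show False using h(2) that by (auto simp: wedge_eq_0_iff)
  qed
  then show "Q1 \<noteq> 0" "Q2 \<noteq> 0" using eigens(1,2) moved_root_distinct by auto
qed

lemma fixed_roots: "\<psi> \<delta> = \<delta> \<longleftrightarrow> \<delta> = \<delta>1 \<or> \<delta> = \<delta>2"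
proof
  assume "\<psi> \<delta> = \<delta>"
  then have "l * wedge \<delta> \<delta>1 * wedge \<delta> \<delta>2 * wedge \<delta> \<delta>3 = 0"
    using h_q[of "proj_x \<delta>" "proj_y \<delta>"] unfolding fixed_iff wedge_def by (simp only: mult.commute mult_zero_left)
  then show "\<delta> = \<delta>1 \<or> \<delta> = \<delta>2" using l_nonzero moved \<open>\<psi> \<delta> = \<delta>\<close> by (auto simp: wedge_eq_0_iff)
next
  assume "\<delta> = \<delta>1 \<or> \<delta> = \<delta>2"
  then show "\<psi> \<delta> = \<delta>" using eigens(4,5) Q_nonzero by auto
qed

lemma \<psi>_pt_linear:
  assumes "\<forall>x y. form_eval e f0 x y = A * x + B * y" "\<forall>x y. form_eval e g0 x y = C * x + D * y"
    and "x \<noteq> 0 \<or> y \<noteq> 0"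
  shows "\<psi> (proj_pt x y) = proj_pt (A * x + B * y) (C * x + D * y)" "A * x + B * y \<noteq> 0 \<or> C * x + D * y \<noteq> 0"
  using eval_red_pt[OF assms(3), of f0 g0 e] base_point_free[OF assms(3)] by (simp_all add: assms(1,2))

text \<open>Diagonalization: the columns of the conjugating matrix are the two fixed directions,
  sending infinity to \<delta>2 and 0 to \<delta>1, and t is the quotient s2 / s1 of their
  eigenvalues.\<close>

lemma conj_scaling:
  assumes "\<delta>1 \<noteq> \<delta>2"
  obtains p q r s t where "p * s - q * r \<noteq> 0" "t \<noteq> 0" "t \<noteq> 1"
    "\<forall>z. \<psi> (mob_k p q r s z) = mob_k p q r s (map_option (\<lambda>x. t * x) z)"
proof -
  obtain A B C D where A: "f0 = [:B, A:]" "g0 = [:D, C:]"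
    "\<forall>x y. form_eval e f0 x y = A * x + B * y" "\<forall>x y. form_eval e g0 x y = C * x + D * y"
    using reduced_linear .
  note \<psi> = \<psi>_pt_linear[OF A(3,4)]
  have *: "\<exists>s. s \<noteq> 0 \<and> A * proj_x \<delta> + B * proj_y \<delta> = s * proj_x \<delta> \<and> C * proj_x \<delta> + D * proj_y \<delta> = s * proj_y \<delta>"
    if "\<psi> \<delta> = \<delta>" for \<delta>
    using \<psi>[OF proj_coords_nonzero[of \<delta>]] that proj_pt_eq_E[of "A * proj_x \<delta> + B * proj_y \<delta>" "C * proj_x \<delta> + D * proj_y \<delta>" \<delta>]
    by (metis proj_pt_coords)
  obtain s1 where s1: "s1 \<noteq> 0" "A * proj_x \<delta>1 + B * proj_y \<delta>1 = s1 * proj_x \<delta>1" "C * proj_x \<delta>1 + D * proj_y \<delta>1 = s1 * proj_y \<delta>1"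
    using *[of \<delta>1] fixed_roots by blast
  obtain s2 where s2: "s2 \<noteq> 0" "A * proj_x \<delta>2 + B * proj_y \<delta>2 = s2 * proj_x \<delta>2" "C * proj_x \<delta>2 + D * proj_y \<delta>2 = s2 * proj_y \<delta>2"
    using *[of \<delta>2] fixed_roots by blast
  let ?M = "mob_k (proj_x \<delta>2) (proj_x \<delta>1) (proj_y \<delta>2) (proj_y \<delta>1)"
  have det: "proj_x \<delta>2 * proj_y \<delta>1 - proj_x \<delta>1 * proj_y \<delta>2 \<noteq> 0"
    using assms wedge_eq_0_iff[of \<delta>2 \<delta>1] by (simp add: wedge_def)
  have conj: "\<psi> (?M z) = ?M (map_option (\<lambda>x. s2 / s1 * x) z)" for z
  proof -
    let ?x = "proj_x z" and ?y = "proj_y z"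
    note nz = proj_coords_nonzero[of z]
    have nz': "s2 * ?x \<noteq> 0 \<or> s1 * ?y \<noteq> 0" using nz s1 s2 by auto
    have "\<psi> (?M (proj_pt ?x ?y)) = proj_pt (A * (proj_x \<delta>2 * ?x + proj_x \<delta>1 * ?y) + B * (proj_y \<delta>2 * ?x + proj_y \<delta>1 * ?y))
        (C * (proj_x \<delta>2 * ?x + proj_x \<delta>1 * ?y) + D * (proj_y \<delta>2 * ?x + proj_y \<delta>1 * ?y))"
      by (simp only: mob_k_pt[OF nz] \<psi>(1)[OF det_nonzero_image[OF det nz]])
    also have "A * (proj_x \<delta>2 * ?x + proj_x \<delta>1 * ?y) + B * (proj_y \<delta>2 * ?x + proj_y \<delta>1 * ?y)
        = proj_x \<delta>2 * (s2 * ?x) + proj_x \<delta>1 * (s1 * ?y)" using s1(2) s2(2) by algebra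
    also have "C * (proj_x \<delta>2 * ?x + proj_x \<delta>1 * ?y) + D * (proj_y \<delta>2 * ?x + proj_y \<delta>1 * ?y)
        = proj_y \<delta>2 * (s2 * ?x) + proj_y \<delta>1 * (s1 * ?y)" using s1(3) s2(3) by algebra
    also have "proj_pt (proj_x \<delta>2 * (s2 * ?x) + proj_x \<delta>1 * (s1 * ?y)) (proj_y \<delta>2 * (s2 * ?x) + proj_y \<delta>1 * (s1 * ?y))
        = ?M (map_option (\<lambda>x. s2 / s1 * x) (proj_pt ?x ?y))"
      by (simp only: mob_k_pt[OF nz'] map_option_mult_pt[OF s1(1)])
    finally show ?thesis by (simp only: proj_pt_coords)
  qed
  \<comment> \<open>With ratio 1 the cancelled map would be the identity and could not move
    \<delta>3.\<close>
  have "s2 / s1 \<noteq> 1"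
  proof
    assume 1: "s2 / s1 = 1"
    obtain z where "?M z = \<delta>3" using mob_k_surj[OF det] .
    moreover have "map_option (\<lambda>x. s2 / s1 * x) z = z" by (cases z) (simp_all add: 1)
    ultimately show False using conj[of z] moved by metis
  qed
  then show thesis using that[OF det _ _ allI[OF conj]] s1(1) s2(1) by simp
qed

text \<open>The basis consists of the only fixed direction, at infinity, and the moved one, at 0.
  The matrix becomes upper triangular with diagonal s, s' and corner d; uniqueness of the fixed
  direction forces s' = s and d nonzero.\<close>

lemma conj_translation:
  assumes "\<delta>1 = \<delta>2"
  obtains p q r s t where "p * s - q * r \<noteq> 0" "t \<noteq> 0"
    "\<forall>z. \<psi> (mob_k p q r s z) = mob_k p q r s (map_option (\<lambda>x. x + t) z)"
proof -
  obtain A B C D where A: "f0 = [:B, A:]" "g0 = [:D, C:]"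
    "\<forall>x y. form_eval e f0 x y = A * x + B * y" "\<forall>x y. form_eval e g0 x y = C * x + D * y"
    using reduced_linear .
  note \<psi> = \<psi>_pt_linear[OF A(3,4)]
  have "\<psi> \<delta>1 = \<delta>1" using fixed_roots by blast
  then obtain s where s: "s \<noteq> 0" "A * proj_x \<delta>1 + B * proj_y \<delta>1 = s * proj_x \<delta>1" "C * proj_x \<delta>1 + D * proj_y \<delta>1 = s * proj_y \<delta>1"
    using \<psi>[OF proj_coords_nonzero[of \<delta>1]] proj_pt_eq_E[of "A * proj_x \<delta>1 + B * proj_y \<delta>1" "C * proj_x \<delta>1 + D * proj_y \<delta>1" \<delta>1]
    by (metis proj_pt_coords)
  let ?M = "mob_k (proj_x \<delta>1) (proj_x \<delta>3) (proj_y \<delta>1) (proj_y \<delta>3)"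
  have det: "proj_x \<delta>1 * proj_y \<delta>3 - proj_x \<delta>3 * proj_y \<delta>1 \<noteq> 0"
    using moved_root_distinct wedge_eq_0_iff[of \<delta>1 \<delta>3] by (simp add: wedge_def)
  define X Y where "X = A * proj_x \<delta>3 + B * proj_y \<delta>3" and "Y = C * proj_x \<delta>3 + D * proj_y \<delta>3"
  \<comment> \<open>Coordinates of the image (X, Y) of the third representative in the basis of the
    first and third ones, by Cramer's rule.\<close>
  define d s' where "d = (X * proj_y \<delta>3 - proj_x \<delta>3 * Y) / (proj_x \<delta>1 * proj_y \<delta>3 - proj_x \<delta>3 * proj_y \<delta>1)"
    and "s' = (proj_x \<delta>1 * Y - X * proj_y \<delta>1) / (proj_x \<delta>1 * proj_y \<delta>3 - proj_x \<delta>3 * proj_y \<delta>1)"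
  have d: "d * (proj_x \<delta>1 * proj_y \<delta>3 - proj_x \<delta>3 * proj_y \<delta>1) = X * proj_y \<delta>3 - proj_x \<delta>3 * Y"
    and s': "s' * (proj_x \<delta>1 * proj_y \<delta>3 - proj_x \<delta>3 * proj_y \<delta>1) = proj_x \<delta>1 * Y - X * proj_y \<delta>1"
    using det by (simp_all add: d_def s'_def)
  have "(proj_x \<delta>1 * proj_y \<delta>3 - proj_x \<delta>3 * proj_y \<delta>1) * X = (proj_x \<delta>1 * proj_y \<delta>3 - proj_x \<delta>3 * proj_y \<delta>1) * (d * proj_x \<delta>1 + s' * proj_x \<delta>3)"
    "(proj_x \<delta>1 * proj_y \<delta>3 - proj_x \<delta>3 * proj_y \<delta>1) * Y = (proj_x \<delta>1 * proj_y \<delta>3 - proj_x \<delta>3 * proj_y \<delta>1) * (d * proj_y \<delta>1 + s' * proj_y \<delta>3)"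
    using d s' by algebra+
  then have XY: "A * proj_x \<delta>3 + B * proj_y \<delta>3 = d * proj_x \<delta>1 + s' * proj_x \<delta>3" "C * proj_x \<delta>3 + D * proj_y \<delta>3 = d * proj_y \<delta>1 + s' * proj_y \<delta>3"
    using det unfolding X_def Y_def by (simp_all only: mult_cancel_left simp_thms)
  have conj: "\<psi> (?M (proj_pt x y)) = ?M (proj_pt (s * x + d * y) (s' * y))"
    and nonsing: "s * x + d * y \<noteq> 0 \<or> s' * y \<noteq> 0" if nz: "x \<noteq> 0 \<or> y \<noteq> 0" for x y
  proof -
    have *: "A * (proj_x \<delta>1 * x + proj_x \<delta>3 * y) + B * (proj_y \<delta>1 * x + proj_y \<delta>3 * y)
        = proj_x \<delta>1 * (s * x + d * y) + proj_x \<delta>3 * (s' * y)" using s(2) XY(1) by algebra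
    have **: "C * (proj_x \<delta>1 * x + proj_x \<delta>3 * y) + D * (proj_y \<delta>1 * x + proj_y \<delta>3 * y)
        = proj_y \<delta>1 * (s * x + d * y) + proj_y \<delta>3 * (s' * y)" using s(3) XY(2) by algebra
    note \<psi>' = \<psi>[OF det_nonzero_image[OF det nz], unfolded * **]
    show nz': "s * x + d * y \<noteq> 0 \<or> s' * y \<noteq> 0" using \<psi>'(2) by (metis add_0 mult_zero_right)
    show "\<psi> (?M (proj_pt x y)) = ?M (proj_pt (s * x + d * y) (s' * y))"
      by (simp only: mob_k_pt[OF nz] mob_k_pt[OF nz'] \<psi>'(1))
  qed
  have M_None: "?M None = \<delta>1" by (cases \<delta>1) (simp_all add: mob_k_def proj_x_def proj_y_def)
  have unique: "z = None" if "\<psi> (?M z) = ?M z" for z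
    using that fixed_roots[of "?M z"] assms M_None mob_k_inj[OF det, of z None] by metis
  \<comment> \<open>Otherwise (d, s' - s) is an eigenvector for s' and gives a second fixed
    direction.\<close>
  have "s' = s"
  proof (rule ccontr)
    assume "s' \<noteq> s"
    then have nz: "d \<noteq> 0 \<or> s' - s \<noteq> 0" by simp
    \<comment> \<open>The vector (-d, s) is sent to (0, s' s), which cannot be zero.\<close>
    have "s' \<noteq> 0"
      using nonsing[of "- d" s] s(1) by (auto simp: mult.commute)
    have "s * d + d * (s' - s) = s' * d" by (simp add: algebra_simps)
    then have "\<psi> (?M (proj_pt d (s' - s))) = ?M (proj_pt d (s' - s))"
      using conj[OF nz] proj_pt_scale[OF \<open>s' \<noteq> 0\<close>, of d "s' - s"] by simp
    then have "proj_pt d (s' - s) = None" by (rule unique)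
    then show False using \<open>s' \<noteq> s\<close> by (simp add: proj_pt_def split: if_splits)
  qed
  have "d \<noteq> 0"
  proof
    assume "d = 0"
    then have "\<psi> (?M (proj_pt 0 1)) = ?M (proj_pt 0 1)" using conj[of 0 1] s(1) \<open>s' = s\<close> by (simp add: proj_pt_def)
    then show False using unique[of "proj_pt 0 1"] by (simp add: proj_pt_def)
  qed
  have "\<psi> (?M z) = ?M (map_option (\<lambda>x. x + d / s) z)" for z
    using conj[OF proj_coords_nonzero[of z]] map_option_add_pt[OF s(1), of d "proj_x z" "proj_y z"] \<open>s' = s\<close> by simp
  then show thesis using that[OF det, of "d / s"] \<open>d \<noteq> 0\<close> s(1) by simp
qed

end

section \<open>Fixed points and multipliers\<close>


lemma splits_proots:
  fixes p :: "'a::field poly"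
  assumes "\<And>p :: 'a poly. degree p > 0 \<Longrightarrow> \<exists>x. poly p x = 0" "p \<noteq> 0"
  shows "p = smult (lead_coeff p) (\<Prod>x\<in>#proots p. [:- x, 1:])" "size (proots p) = degree p"
proof -
  have "p = smult (lead_coeff p) (\<Prod>x\<in>#proots p. [:- x, 1:]) \<and> size (proots p) = degree p"
    using assms(2)
  proof (induction "degree p" arbitrary: p)
    case 0
    then obtain k where "p = [:k:]" by (metis degree_eq_zeroE)
    then show ?case by simp
  next
    case (Suc n)
    then obtain x where "poly p x = 0" using assms(1)[of p] by auto
    then obtain r where r: "p = [:- x, 1:] * r" by (metis dvdE poly_eq_0_iff_dvd)
    have "r \<noteq> 0" using r Suc.prems by auto
    have "degree p = 1 + degree r" unfolding r using \<open>r \<noteq> 0\<close> by (subst degree_mult_eq) auto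
    then have "n = degree r" using Suc.hyps by simp
    note IH = Suc.hyps(1)[OF this \<open>r \<noteq> 0\<close>]
    have pr: "proots p = {#x#} + proots r"
      unfolding r using \<open>r \<noteq> 0\<close> by (subst proots_mult) auto
    have lc: "lead_coeff p = lead_coeff r" unfolding r by (simp add: lead_coeff_mult del: mult_pCons_left)
    have "p = [:- x, 1:] * smult (lead_coeff r) (\<Prod>x\<in>#proots r. [:- x, 1:])"
      using r IH by metis
    also have "\<dots> = smult (lead_coeff p) (\<Prod>x\<in>#proots p. [:- x, 1:])"
      by (simp only: pr lc mult_smult_right image_mset_union image_mset_single prod_mset.union prod_mset_singleton)
    finally show ?case using IH \<open>degree p = _\<close> by (simp add: pr)
  qed
  then show "p = smult (lead_coeff p) (\<Prod>x\<in>#proots p. [:- x, 1:])" "size (proots p) = degree p"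
    by blast+
qed

lemma size_3_E:
  assumes "size B = 3"
  obtains a b c where "B = {#a, b, c#}"
proof -
  obtain a A where A: "B = add_mset a A" "size A = 2"
    using size_eq_Suc_imp_eq_union[of B 2] assms by auto
  obtain b A' where A': "A = add_mset b A'" "size A' = 1"
    using size_eq_Suc_imp_eq_union[of A 1] A by auto
  obtain c where "A' = {#c#}" using A'(2) size_1_singleton_mset by auto
  then show thesis using that A A' by simp
qed

text \<open>An ordered list with multiplicity in which infinity is an ordinary entry. Fixing an
  order makes the three multipliers addressable, and the order can be permuted when a particular
  fixed point has to come last.\<close>

definition fixed_triple :: "'a::field poly \<Rightarrow> 'a poly \<Rightarrow> 'a option \<Rightarrow> 'a option \<Rightarrow> 'a option \<Rightarrow> bool" where
  "fixed_triple F G \<alpha>1 \<alpha>2 \<alpha>3 \<longleftrightarrow>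
    (\<exists>l. fix_poly F G = smult l ([:- proj_x \<alpha>1, proj_y \<alpha>1:] * ([:- proj_x \<alpha>2, proj_y \<alpha>2:] * [:- proj_x \<alpha>3, proj_y \<alpha>3:])))
    \<and> {\<alpha>. is_fixed F G \<alpha>} = {\<alpha>1, \<alpha>2, \<alpha>3}
    \<and> fix_mults F G = {#multiplier F G \<alpha>1, multiplier F G \<alpha>2, multiplier F G \<alpha>3#}"

lemma fixed_triple_swap12: "fixed_triple F G \<alpha>1 \<alpha>2 \<alpha>3 \<Longrightarrow> fixed_triple F G \<alpha>2 \<alpha>1 \<alpha>3"
  unfolding fixed_triple_def mult.left_commute[of "[:- proj_x \<alpha>2, proj_y \<alpha>2:]"] insert_commute[of \<alpha>2]
    add_mset_commute[of "multiplier F G \<alpha>2"] .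

lemma fixed_triple_swap23: "fixed_triple F G \<alpha>1 \<alpha>2 \<alpha>3 \<Longrightarrow> fixed_triple F G \<alpha>1 \<alpha>3 \<alpha>2"
  unfolding fixed_triple_def mult.commute[of "[:- proj_x \<alpha>3, proj_y \<alpha>3:]"] insert_commute[of \<alpha>3]
    add_mset_commute[of "multiplier F G \<alpha>3"] .

text \<open>Vanishing would make the map the identity, which does not have degree 2.\<close>

lemma fix_poly_nonzero:
  assumes "rat_deg2 F G"
  shows "fix_poly F G \<noteq> 0"
proof
  assume "fix_poly F G = 0"
  then have F: "F = [:0, 1:] * G" by (simp add: fix_poly_def)
  then have "G dvd F" using dvd_triv_right by blast
  then have "is_unit G"
    using assms coprime_common_divisor[of F G G] by (simp add: rat_deg2_def)
  then have "degree G = 0" by (metis is_unit_polyE degree_pCons_0)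
  moreover have "degree F \<le> 1 + degree G" unfolding F using degree_mult_le[of "[:0, 1:]" G] by simp
  ultimately show False using assms by (simp add: rat_deg2_def)
qed

lemma degree_fix_poly:
  assumes "rat_deg2 F G"
  shows "degree (fix_poly F G) \<le> 3"
proof -
  have "degree F \<le> 2" "degree G \<le> 2" using assms by (auto simp: rat_deg2_def)
  moreover have "degree ([:0, 1:] * G) \<le> 1 + degree G" using degree_mult_le[of "[:0, 1:]" G] by simp
  ultimately show ?thesis unfolding fix_poly_def by (intro degree_diff_le) linarith+
qed

lemma fixed_triple_exists:
  fixes F G :: "'a::field poly"
  assumes "\<And>p :: 'a poly. degree p > 0 \<Longrightarrow> \<exists>x. poly p x = 0" "rat_deg2 F G"
  obtains \<alpha>1 \<alpha>2 \<alpha>3 where "fixed_triple F G \<alpha>1 \<alpha>2 \<alpha>3"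
proof -
  let ?p = "fix_poly F G"
  note nz = fix_poly_nonzero[OF assms(2)]
  note splits = splits_proots[OF assms(1) nz]
  \<comment> \<open>The drop of the degree below 3 is the multiplicity of infinity as a fixed
    point.\<close>
  define B where "B = image_mset Some (proots ?p) + replicate_mset (3 - degree ?p) None"
  have "size B = 3" using splits(2) degree_fix_poly[OF assms(2)] by (simp add: B_def)
  then obtain \<alpha>1 \<alpha>2 \<alpha>3 where B: "B = {#\<alpha>1, \<alpha>2, \<alpha>3#}" by (rule size_3_E)
  \<comment> \<open>Each copy of infinity contributes the factor -1, whence the sign.\<close>
  have prodB: "(\<Prod>\<alpha>\<in>#B. [:- proj_x \<alpha>, proj_y \<alpha>:]) =
      (-1) ^ (3 - degree ?p) * (\<Prod>x\<in>#proots ?p. [:- x, 1:])"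
  proof -
    have N: "[:- proj_x None, proj_y None:] = (- 1 :: 'a poly)" by (simp add: proj_x_def proj_y_def one_pCons)
    have S: "[:- proj_x (Some x), proj_y (Some x):] = [:- x, 1:]" for x :: 'a by (simp add: proj_x_def proj_y_def)
    show ?thesis
      by (simp add: B_def N S image_mset.compositionality o_def mult.commute)
  qed
  have "?p = smult (lead_coeff ?p * (-1) ^ (3 - degree ?p)) (\<Prod>\<alpha>\<in>#B. [:- proj_x \<alpha>, proj_y \<alpha>:])"
    using splits(1) unfolding prodB by (cases "even (3 - degree ?p)") simp_all
  moreover have "{\<alpha>. is_fixed F G \<alpha>} = set_mset B"
  proof (intro set_eqI)
    fix \<alpha> show "\<alpha> \<in> {\<alpha>. is_fixed F G \<alpha>} \<longleftrightarrow> \<alpha> \<in> set_mset B"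
      using nz by (cases \<alpha>) (auto simp: B_def is_fixed_def in_replicate_mset)
  qed
  moreover have "fix_mults F G = image_mset (multiplier F G) B"
  proof -
    have "(\<Sum>x\<in>{x. poly ?p x = 0}. replicate_mset (order x ?p) (multiplier F G (Some x)))
      = (\<Sum>x\<in>set_mset (proots ?p). image_mset (\<lambda>x. multiplier F G (Some x)) (replicate_mset (count (proots ?p) x) x))"
      using nz by simp
    also have "\<dots> = image_mset (\<lambda>x. multiplier F G (Some x)) (\<Sum>x\<in>set_mset (proots ?p). replicate_mset (count (proots ?p) x) x)"
      by (rule sum_comp_morphism[unfolded o_def]) simp_all
    also have "(\<Sum>x\<in>set_mset (proots ?p). replicate_mset (count (proots ?p) x) x) = proots ?p"
      by (rule multiset_eqI) (auto simp: count_sum sum.delta' not_in_iff)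
    finally show ?thesis
      by (simp add: fix_mults_def Let_def B_def image_mset.compositionality o_def)
  qed
  ultimately have "fixed_triple F G \<alpha>1 \<alpha>2 \<alpha>3"
    unfolding fixed_triple_def B by (auto simp del: mult_pCons_left)
  then show thesis by (rule that)
qed

section \<open>Behaviour of fixed points and multipliers under affine conjugation\<close>

definition coord_change :: "'a::field \<Rightarrow> 'a \<Rightarrow> 'a option \<Rightarrow> 'a option" where
  "coord_change a c = map_option (\<lambda>x. (x - a) / c)"

lemma pcompose_point:
  fixes a c :: "'a::field"
  assumes "c \<noteq> 0"
  obtains k where "k \<noteq> 0" "pcompose [:- proj_x \<alpha>, proj_y \<alpha>:] [:a, c:]
    = smult k [:- proj_x (coord_change a c \<alpha>), proj_y (coord_change a c \<alpha>):]"
proof (cases \<alpha>)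
  case None
  then show thesis using that[of 1] by (simp add: proj_x_def proj_y_def coord_change_def pcompose_pCons)
next
  case (Some x)
  have "pcompose [:- proj_x \<alpha>, proj_y \<alpha>:] [:a, c:] = smult c [:- proj_x (coord_change a c \<alpha>), proj_y (coord_change a c \<alpha>):]"
    using assms Some by (simp add: proj_x_def proj_y_def coord_change_def pcompose_pCons)
  then show thesis using that[of c] assms by blast
qed

text \<open>Because \<open>conj_pair\<close> clears the denominator c, the expression (a + c z) G -
  F regroups as z (c G) - (F - a G), with no extra factor.\<close>

lemma fix_poly_conj:
  "fix_poly (smult s (fst (conj_pair F G a c))) (smult s (snd (conj_pair F G a c)))
    = smult s (pcompose (fix_poly F G) [:a, c:])"
proof -
  let ?F = "pcompose F [:a, c:]" and ?G = "pcompose G [:a, c:]"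
  have "pcompose ([:0, 1:] * G) [:a, c:] = [:a, c:] * ?G"
    by (simp only: pcompose_mult) (simp add: pcompose_pCons)
  also have "\<dots> = smult a ?G + [:0, 1:] * smult c ?G" by simp
  finally have "pcompose (fix_poly F G) [:a, c:] = [:0, 1:] * smult c ?G - (?F - smult a ?G)"
    by (simp add: fix_poly_def pcompose_diff del: mult_pCons_left)
  moreover have "fix_poly (smult s P) (smult s R) = smult s ([:0, 1:] * R - P)" for P R
    by (simp only: fix_poly_def mult_smult_right smult_diff_right)
  ultimately show ?thesis by (simp only: conj_pair_def Let_def fst_conv snd_conv)
qed

lemma coeff_2_pcompose_linear:
  fixes p :: "'a::field poly"
  assumes "degree p \<le> 2"
  shows "coeff (pcompose p [:a, c:]) 2 = c\<^sup>2 * coeff p 2"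
    "coeff (pcompose p [:a, c:]) 1 = c * coeff p 1 + 2 * a * c * coeff p 2"
proof -
  obtain p2 p1 p0 where "p = [:p0, p1, p2:]" using assms degree_le_2_E by blast
  then show "coeff (pcompose p [:a, c:]) 2 = c\<^sup>2 * coeff p 2"
    "coeff (pcompose p [:a, c:]) 1 = c * coeff p 1 + 2 * a * c * coeff p 2"
    by (simp_all add: pcompose_pCons coeff_pCons numeral_2_eq_2 algebra_simps)
qed

text \<open>The chain rule. An affine change preserves the derivative at every finite point, but the
  expression in the chart 1/z is invariant only if infinity is fixed, hence the condition on
  \<open>coeff G 2\<close>.\<close>

lemma multiplier_conj:
  fixes F G :: "'a::field poly"
  assumes "degree F \<le> 2" "degree G \<le> 2" "s \<noteq> 0" "c \<noteq> 0" "\<alpha> = None \<Longrightarrow> coeff G 2 = 0"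
  shows "multiplier (smult s (fst (conj_pair F G a c))) (smult s (snd (conj_pair F G a c))) (coord_change a c \<alpha>)
    = multiplier F G \<alpha>"
proof (cases \<alpha>)
  case None
  have "coeff (pcompose F [:a, c:] - smult a (pcompose G [:a, c:])) 2 = c\<^sup>2 * coeff F 2"
    "coeff (pcompose G [:a, c:]) 2 = 0" "coeff (pcompose G [:a, c:]) 1 = c * coeff G 1"
    using assms None coeff_2_pcompose_linear[of F a c] coeff_2_pcompose_linear[of G a c] by simp_all
  then show ?thesis
    using None assms by (simp add: coord_change_def multiplier_def conj_pair_def Let_def power2_eq_square)
next
  case (Some x)
  have x: "a + c * ((x - a) / c) = x" using assms by simp
  let ?F = "pcompose F [:a, c:]" and ?G = "pcompose G [:a, c:]"
  have val: "poly ?F ((x - a) / c) = poly F x" "poly ?G ((x - a) / c) = poly G x"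
    "poly (pderiv ?F) ((x - a) / c) = c * poly (pderiv F) x" "poly (pderiv ?G) ((x - a) / c) = c * poly (pderiv G) x"
    using assms by (simp_all add: poly_pcompose pderiv_pcompose pderiv_pCons)
  have "multiplier (smult s (fst (conj_pair F G a c))) (smult s (snd (conj_pair F G a c))) (coord_change a c \<alpha>)
    = ((s * c)\<^sup>2 * (poly (pderiv F) x * poly G x - poly F x * poly (pderiv G) x)) / ((s * c)\<^sup>2 * (poly G x)\<^sup>2)"
    by (simp add: Some coord_change_def multiplier_def conj_pair_def Let_def pderiv_smult pderiv_diff val
        power2_eq_square algebra_simps del: mult_divide_mult_cancel_left_if)
  also have "\<dots> = multiplier F G \<alpha>" using assms by (simp add: Some multiplier_def)
  finally show ?thesis .
qed

text \<open>One minus the multiplier is the derivative of z - F/G = (z G - F)/G. At a zero of the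
  numerator only the numerator is differentiated, and of the product only its vanishing linear
  factor.\<close>

lemma multiplier_formula:
  fixes F G R :: "'a::field poly"
  assumes "degree F \<le> 2" "degree G \<le> 2" "degree R \<le> 2"
    and p: "fix_poly F G = smult l ([:- u, v:] * R)"
    and finite: "v \<noteq> 0 \<Longrightarrow> poly G (u / v) \<noteq> 0"
    and infinite: "v = 0 \<Longrightarrow> u = 1 \<and> coeff F 2 \<noteq> 0"
  obtains Q where "Q \<noteq> 0" "form_eval 2 F u v = Q * u" "form_eval 2 G u v = Q * v"
    "Q * multiplier F G (proj_pt u v) = Q - l * form_eval 2 R u v"
proof (cases "v = 0")
  case True
  then have u: "u = 1" and F: "coeff F 2 \<noteq> 0" using infinite by auto
  have "coeff (fix_poly F G) 3 = coeff G 2" "coeff (fix_poly F G) 2 = coeff G 1 - coeff F 2"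
    using assms(1) by (simp_all add: fix_poly_def coeff_pCons coeff_eq_0 numeral_3_eq_3 numeral_2_eq_2)
  then have "coeff (smult l ([:- u, v:] * R)) 3 = coeff G 2"
    "coeff (smult l ([:- u, v:] * R)) 2 = coeff G 1 - coeff F 2"
    by (simp_all only: p)
  moreover have "coeff (smult l ([:- u, v:] * R)) 3 = 0" "coeff (smult l ([:- u, v:] * R)) 2 = - l * coeff R 2"
    using assms(3) by (simp_all add: True u coeff_eq_0)
  ultimately have "coeff G 2 = 0" "coeff G 1 - coeff F 2 = - l * coeff R 2" by metis+
  then have "coeff G 2 = 0" "coeff G 1 = coeff F 2 - l * coeff R 2" by (simp_all add: algebra_simps)
  then show thesis
    using that[of "coeff F 2"] F by (simp add: True u form_eval_def proj_pt_def multiplier_def power2_eq_square)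
next
  case False
  define y where "y = u / v"
  have u: "u = y * v" using False by (simp add: y_def)
  have G: "poly G y \<noteq> 0" using finite[OF False] by (simp add: y_def)
  have root: "poly [:- u, v:] y = 0" by (simp add: u)
  have F: "poly F y = y * poly G y"
    using arg_cong[OF p, of "\<lambda>p. poly p y"] root by (simp add: fix_poly_def del: mult_pCons_left)
  have "poly (pderiv (fix_poly F G)) y = l * v * poly R y"
    unfolding p using root by (simp add: pderiv_smult pderiv_mult pderiv_pCons del: mult_pCons_left)
  then have d: "poly G y + y * poly (pderiv G) y - poly (pderiv F) y = l * v * poly R y"
    by (simp add: fix_poly_def pderiv_diff pderiv_mult pderiv_pCons)
  have "multiplier F G (Some y) = (poly (pderiv F) y - y * poly (pderiv G) y) / poly G y"
    using G by (simp add: multiplier_def F power2_eq_square field_simps)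
  also have "poly (pderiv F) y - y * poly (pderiv G) y = poly G y - l * v * poly R y"
    using d by (simp add: algebra_simps)
  finally have m: "poly G y * multiplier F G (Some y) = poly G y - l * v * poly R y"
    using G by simp
  \<comment> \<open>The form of G has value v^2 G(y) = (v G(y)) v, so the eigenvalue must be v
    G(y).\<close>
  show thesis
  proof (rule that[of "v * poly G y"])
    have "v * (poly G y * multiplier F G (Some y)) = v * (poly G y - l * v * poly R y)"
      using m by simp
    then show "v * poly G y * multiplier F G (proj_pt u v) = v * poly G y - l * form_eval 2 R u v"
      using False by (simp add: proj_pt_def form_eval_def power2_eq_square algebra_simps flip: y_def)
  qed (use G False F in \<open>simp_all add: form_eval_def power2_eq_square u\<close>)
qed

section \<open>Reduction modulo the maximal ideal\<close>


lemma proj_eq_scale: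
  fixes k :: "'k::field_gcd"
  assumes "k \<noteq> 0"
  shows "proj_eq (k * x, k * y, k * z) w \<longleftrightarrow> proj_eq (x, y, z) w"
proof
  assume "proj_eq (k * x, k * y, k * z) w"
  then obtain \<nu> where "\<nu> \<noteq> 0" "k * x = \<nu> * fst w" "k * y = \<nu> * fst (snd w)" "k * z = \<nu> * snd (snd w)"
    by (auto simp: proj_eq_def)
  then show "proj_eq (x, y, z) w"
    unfolding proj_eq_def using assms by (intro exI[of _ "\<nu> / k"]) (simp add: field_simps)
next
  assume "proj_eq (x, y, z) w"
  then obtain \<nu> where "\<nu> \<noteq> 0" "x = \<nu> * fst w" "y = \<nu> * fst (snd w)" "z = \<nu> * snd (snd w)"
    by (auto simp: proj_eq_def)
  then show "proj_eq (k * x, k * y, k * z) w"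
    unfolding proj_eq_def using assms by (intro exI[of _ "k * \<nu>"]) simp
qed

locale valued_field =
  fixes nv :: "'a::field \<Rightarrow> real" and red :: "'a \<Rightarrow> 'k::field_gcd"
  assumes nonarch: "nonarch_abs nv" and residue: "residue_map nv red"
begin

lemma nv_nonneg: "nv x \<ge> 0" and nv_eq_0 [simp]: "nv x = 0 \<longleftrightarrow> x = 0"
  and nv_mult: "nv (x * y) = nv x * nv y" and nv_add: "nv (x + y) \<le> max (nv x) (nv y)"
  using nonarch by (auto simp: nonarch_abs_def)

lemma nv_0 [simp]: "nv 0 = 0"
  by (simp only: nv_eq_0)

lemma nv_1 [simp]: "nv 1 = 1"
  using nv_mult[of 1 1] nv_eq_0[of 1] by auto

lemma nv_minus [simp]: "nv (- x) = nv x"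
proof -
  have "nv (- 1) * nv (- 1) = 1" using nv_mult[of "- 1" "- 1"] by simp
  then have "nv (- 1) = 1" using nv_nonneg[of "- 1"] by (auto simp: square_eq_1_iff)
  then show ?thesis using nv_mult[of "- 1" x] by simp
qed

lemma nv_inverse: "nv (inverse x) = inverse (nv x)"
  using nv_mult[of x "inverse x"] by (cases "x = 0") (auto simp: field_simps)

lemma nv_divide: "nv (x / y) = nv x / nv y"
  by (simp add: divide_inverse nv_mult nv_inverse)

lemma nonzero_if_not_integral: "\<not> nv x \<le> 1 \<Longrightarrow> x \<noteq> 0"
  by auto

lemma integral_closed:
  "nv x \<le> 1 \<Longrightarrow> nv y \<le> 1 \<Longrightarrow> nv (x + y) \<le> 1"
  "nv x \<le> 1 \<Longrightarrow> nv y \<le> 1 \<Longrightarrow> nv (x - y) \<le> 1"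
  "nv x \<le> 1 \<Longrightarrow> nv y \<le> 1 \<Longrightarrow> nv (x * y) \<le> 1"
  using nv_add[of x y] nv_add[of x "- y"] mult_mono[of "nv x" 1 "nv y" 1] nv_nonneg[of x] nv_nonneg[of y]
  by (auto simp: nv_mult)

lemma red_add: "nv x \<le> 1 \<Longrightarrow> nv y \<le> 1 \<Longrightarrow> red (x + y) = red x + red y"
  and red_mult: "nv x \<le> 1 \<Longrightarrow> nv y \<le> 1 \<Longrightarrow> red (x * y) = red x * red y"
  and red_1 [simp]: "red 1 = 1"
  and red_eq_0_iff: "nv x \<le> 1 \<Longrightarrow> red x = 0 \<longleftrightarrow> nv x < 1"
  using residue by (auto simp: residue_map_def)

lemma red_0 [simp]: "red 0 = 0"
  using red_eq_0_iff[of 0] by simp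

lemma red_minus: "nv x \<le> 1 \<Longrightarrow> red (- x) = - red x"
  using red_add[of x "- x"] by (simp add: eq_neg_iff_add_eq_0 add.commute)

lemma red_diff: "nv x \<le> 1 \<Longrightarrow> nv y \<le> 1 \<Longrightarrow> red (x - y) = red x - red y"
  using red_add[of x "- y"] red_minus[of y] by simp

lemma red_nonzero_iff: "nv x \<le> 1 \<Longrightarrow> red x \<noteq> 0 \<longleftrightarrow> nv x = 1"
  using red_eq_0_iff[of x] by auto

lemma red_inverse_eq_0: "\<not> nv x \<le> 1 \<Longrightarrow> red (inverse x) = 0"
  by (subst red_eq_0_iff) (auto simp: nv_inverse inverse_le_1_iff inverse_less_1_iff)

section \<open>Integral polynomials, primitive coordinates and normalized lifts\<close>

definition integral_poly :: "'a poly \<Rightarrow> bool" where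
  "integral_poly p \<longleftrightarrow> (\<forall>i. nv (coeff p i) \<le> 1)"

lemma coeff_map_red [simp]: "coeff (map_poly red p) i = red (coeff p i)"
  by (simp add: coeff_map_poly)

lemma sum_red:
  assumes "finite A" "\<And>i. i \<in> A \<Longrightarrow> nv (h i) \<le> 1"
  shows "nv (sum h A) \<le> 1" "red (sum h A) = (\<Sum>i\<in>A. red (h i))"
proof -
  have "nv (sum h A) \<le> 1 \<and> red (sum h A) = (\<Sum>i\<in>A. red (h i))"
    using assms by (induction A) (auto simp: red_add integral_closed)
  then show "nv (sum h A) \<le> 1" "red (sum h A) = (\<Sum>i\<in>A. red (h i))" by auto
qed

lemma integral_poly_mult:
  assumes "integral_poly p" "integral_poly q"
  shows "integral_poly (p * q)" "map_poly red (p * q) = map_poly red p * map_poly red q"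
proof -
  have *: "nv (coeff p i * coeff q j) \<le> 1" "red (coeff p i * coeff q j) = red (coeff p i) * red (coeff q j)" for i j
    using assms by (simp_all add: integral_poly_def red_mult integral_closed)
  show "integral_poly (p * q)"
    unfolding integral_poly_def coeff_mult using * by (auto intro!: sum_red)
  show "map_poly red (p * q) = map_poly red p * map_poly red q"
    by (rule poly_eqI) (simp add: coeff_mult sum_red * )
qed

lemma integral_poly_diff:
  assumes "integral_poly p" "integral_poly q"
  shows "integral_poly (p - q)" "map_poly red (p - q) = map_poly red p - map_poly red q"
  using assms by (auto simp: integral_poly_def integral_closed red_diff intro!: poly_eqI)

lemma integral_poly_smult:
  assumes "nv k \<le> 1" "integral_poly p"
  shows "integral_poly (smult k p)" "map_poly red (smult k p) = smult (red k) (map_poly red p)"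
  using assms by (auto simp: integral_poly_def integral_closed red_mult intro!: poly_eqI)

lemma integral_poly_linear:
  assumes "nv u \<le> 1" "nv v \<le> 1"
  shows "integral_poly [:u, v:]" "map_poly red [:u, v:] = [:red u, red v:]"
  using assms by (auto simp: integral_poly_def coeff_pCons red_minus split: nat.splits intro!: poly_eqI)

text \<open>The division inside \<open>form_eval\<close> does not commute with reduction when v
  reduces to 0, so the quadratic is expanded first.\<close>

lemma form_eval_2_red:
  assumes "integral_poly p" "degree p \<le> 2" "nv u \<le> 1" "nv v \<le> 1"
  shows "nv (form_eval 2 p u v) \<le> 1" "form_eval 2 (map_poly red p) (red u) (red v) = red (form_eval 2 p u v)"
proof -
  obtain p2 p1 p0 where p: "p = [:p0, p1, p2:]" using assms(2) degree_le_2_E by blast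
  have i: "nv p0 \<le> 1" "nv p1 \<le> 1" "nv p2 \<le> 1"
    using assms(1)[unfolded integral_poly_def p, THEN spec, of 0] assms(1)[unfolded integral_poly_def p, THEN spec, of 1]
      assms(1)[unfolded integral_poly_def p, THEN spec, of 2]
    by (simp_all add: coeff_pCons numeral_2_eq_2)
  have m: "map_poly red p = [:red p0, red p1, red p2:]"
    by (rule poly_eqI) (auto simp: p coeff_pCons split: nat.splits)
  show "nv (form_eval 2 p u v) \<le> 1"
    using i assms(3,4) by (simp add: p form_eval_quadratic integral_closed power2_eq_square)
  show "form_eval 2 (map_poly red p) (red u) (red v) = red (form_eval 2 p u v)"
    using i assms(3,4) by (simp add: p m[unfolded p] form_eval_quadratic integral_closed power2_eq_square red_add red_mult)
qed

text \<open>A point outside the unit disc is represented by (1, 1/y), so both coordinates are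
  integral and one of them is 1.\<close>

definition crd_x :: "'a option \<Rightarrow> 'a" where
  "crd_x \<alpha> = (case \<alpha> of None \<Rightarrow> 1 | Some y \<Rightarrow> if nv y \<le> 1 then y else 1)"

definition crd_y :: "'a option \<Rightarrow> 'a" where
  "crd_y \<alpha> = (case \<alpha> of None \<Rightarrow> 0 | Some y \<Rightarrow> if nv y \<le> 1 then 1 else inverse y)"

lemma crd_integral: "nv (crd_x \<alpha>) \<le> 1" "nv (crd_y \<alpha>) \<le> 1"
  by (auto simp: crd_x_def crd_y_def nv_inverse inverse_le_1_iff split: option.splits)

lemma crd_unit: "crd_x \<alpha> = 1 \<or> crd_y \<alpha> = 1"
  by (auto simp: crd_x_def crd_y_def split: option.splits)

lemma crd_y_0: "crd_y \<alpha> = 0 \<longleftrightarrow> \<alpha> = None"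
  by (auto simp: crd_x_def crd_y_def split: option.splits)

lemma crd_None: "crd_x None = 1" "crd_y None = 0"
  by (simp_all add: crd_x_def crd_y_def)

lemma proj_pt_crd: "proj_pt (crd_x \<alpha>) (crd_y \<alpha>) = \<alpha>"
  by (auto simp: crd_x_def crd_y_def proj_pt_def divide_inverse dest: nonzero_if_not_integral split: option.splits)

text \<open>Equality, not mere proportionality: the primitive coordinates are chosen to reduce
  exactly to the fixed representatives over k, so no scalars have to be carried along.\<close>

lemma red_crd:
  "red (crd_x (coord_change a c \<alpha>)) = proj_x (dir_cl nv red a c \<alpha>)"
  "red (crd_y (coord_change a c \<alpha>)) = proj_y (dir_cl nv red a c \<alpha>)"
  by (auto simp: crd_x_def crd_y_def proj_x_def proj_y_def dir_cl_def coord_change_def red_inverse_eq_0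
      simp del: inverse_divide split: option.splits)

lemma crd_scale: obtains k where "[:- proj_x \<alpha>, proj_y \<alpha>:] = smult k [:- crd_x \<alpha>, crd_y \<alpha>:]"
proof -
  have "[:- proj_x \<alpha>, proj_y \<alpha>:] = smult (case \<alpha> of None \<Rightarrow> 1 | Some y \<Rightarrow> if nv y \<le> 1 then 1 else y) [:- crd_x \<alpha>, crd_y \<alpha>:]"
    by (auto simp: crd_x_def crd_y_def proj_x_def proj_y_def dest: nonzero_if_not_integral split: option.splits)
  then show thesis by (rule that)
qed

lemma SOME_max:
  fixes S :: "'a set"
  assumes "finite S" "S \<noteq> {}"
  shows "(SOME t. t \<in> S \<and> (\<forall>s\<in>S. nv s \<le> nv t)) \<in> S"
    "s \<in> S \<Longrightarrow> nv s \<le> nv (SOME t. t \<in> S \<and> (\<forall>s\<in>S. nv s \<le> nv t))"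
proof -
  have "\<exists>t. t \<in> S \<and> (\<forall>s\<in>S. nv s \<le> nv t)"
    using assms ex_is_arg_min_if_finite[of S "\<lambda>x. - nv x"] by (auto simp: is_arg_min_linorder)
  from someI_ex[OF this] show "(SOME t. t \<in> S \<and> (\<forall>s\<in>S. nv s \<le> nv t)) \<in> S"
    "s \<in> S \<Longrightarrow> nv s \<le> nv (SOME t. t \<in> S \<and> (\<forall>s\<in>S. nv s \<le> nv t))"
    by blast+
qed

text \<open>Any integral coordinates with nonzero reduction compute the specialization. The
  coordinate of maximal absolute value, times M, is one of N1, N2, M; it has absolute value 1, so
  the normalization in \<open>spec3\<close> differs from the given coordinates by a unit.\<close>

lemma spec3_proj:
  assumes int: "nv N1 \<le> 1" "nv N2 \<le> 1" "nv M \<le> 1" and M: "M \<noteq> 0"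
    and nz: "red N1 \<noteq> 0 \<or> red N2 \<noteq> 0 \<or> red M \<noteq> 0" and xy: "x * M = N1" "y * M = N2"
  shows "proj_eq (spec3 nv red (x, y, 1)) w \<longleftrightarrow> proj_eq (red N1, red N2, red M) w"
proof -
  define S where "S = {x, y, 1}"
  define t where "t = (SOME t. t \<in> S \<and> (\<forall>s\<in>S. nv s \<le> nv t))"
  have S: "finite S" "S \<noteq> {}" by (simp_all add: S_def)
  have t: "t \<in> S" "\<And>s. s \<in> S \<Longrightarrow> nv s \<le> nv t"
    unfolding t_def using SOME_max[OF S] by blast+
  define W where "W = t * M"
  have "nv t \<ge> 1" using t(2)[of 1] by (simp add: S_def)
  then have "t \<noteq> 0" by auto
  then have "W \<noteq> 0" using M by (simp add: W_def)
  have W_in: "W \<in> {N1, N2, M}" using t(1) xy by (auto simp: W_def S_def)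
  have ge: "nv N1 \<le> nv W" "nv N2 \<le> nv W" "nv M \<le> nv W"
    using t(2) nv_nonneg[of M] unfolding xy[symmetric] W_def nv_mult
    by (auto simp: S_def mult_right_mono) (metis mult_right_mono mult_1 nv_1 insertCI)
  have W1: "nv W = 1"
    using ge W_in int nz by (auto simp: red_nonzero_iff)
  define \<mu> where "\<mu> = red (inverse W)"
  have inv: "nv (inverse W) \<le> 1" using W1 by (simp add: nv_inverse)
  have \<mu>: "\<mu> \<noteq> 0" unfolding \<mu>_def using W1 by (subst red_nonzero_iff) (simp_all add: nv_inverse)
  have spec: "spec3 nv red (x, y, 1) = (red (x / t), red (y / t), red (1 / t))"
    by (simp only: spec3_def Let_def prod.case t_def S_def)
  have "x / t = N1 * inverse W" "y / t = N2 * inverse W" "1 / t = M * inverse W"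
    using M \<open>t \<noteq> 0\<close> by (simp_all add: W_def field_simps flip: xy)
  then have "spec3 nv red (x, y, 1) = (\<mu> * red N1, \<mu> * red N2, \<mu> * red M)"
    by (simp add: red_mult[OF _ inv] int \<mu>_def spec mult.commute)
  then show ?thesis by (simp only: proj_eq_scale[OF \<mu>])
qed

lemma red_pair_scaling:
  assumes "P \<noteq> 0 \<or> R \<noteq> 0" "degree P \<le> 2" "degree R \<le> 2"
  obtains s where "s \<noteq> 0" "red_pair nv red (P, R) = (map_poly red (smult s P), map_poly red (smult s R))"
    "integral_poly (smult s P)" "integral_poly (smult s R)"
    "map_poly red (smult s P) \<noteq> 0 \<or> map_poly red (smult s R) \<noteq> 0"
proof -
  define S where "S = {coeff P i | i. i \<le> 2} \<union> {coeff R i | i. i \<le> 2}"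
  define t where "t = (SOME t. t \<in> S \<and> (\<forall>s\<in>S. nv s \<le> nv t))"
  have S: "finite S" "S \<noteq> {}" by (auto simp: S_def)
  have t: "t \<in> S" "\<And>s. s \<in> S \<Longrightarrow> nv s \<le> nv t"
    unfolding t_def using SOME_max[OF S] by blast+
  obtain r where "r \<in> S" "r \<noteq> 0"
    using assms unfolding S_def
    by (metis (mono_tags, lifting) UnCI leading_coeff_0_iff mem_Collect_eq)
  then have "t \<noteq> 0" using t(2)[of r] nv_nonneg[of r] nv_eq_0[of r] nv_eq_0[of t] by force
  have small: "nv (inverse t * r) \<le> 1" if "r \<in> S" for r
  proof -
    have "nv (inverse t * r) = nv r / nv t"
      by (simp only: nv_mult nv_inverse divide_inverse mult.commute)
    moreover have "nv t > 0" using \<open>t \<noteq> 0\<close> nv_nonneg[of t] nv_eq_0[of t] by linarith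
    ultimately show ?thesis using t(2)[OF that] by simp
  qed
  have int: "integral_poly (smult (inverse t) P)" "integral_poly (smult (inverse t) R)"
    unfolding integral_poly_def
  proof (safe)
    fix i
    show "nv (coeff (smult (inverse t) P) i) \<le> 1"
      using small[of "coeff P i"] assms(2) by (cases "i \<le> 2") (auto simp: S_def coeff_eq_0)
    show "nv (coeff (smult (inverse t) R) i) \<le> 1"
      using small[of "coeff R i"] assms(3) by (cases "i \<le> 2") (auto simp: S_def coeff_eq_0)
  qed
  obtain i where i: "t = coeff P i \<or> t = coeff R i" using t(1) by (auto simp: S_def)
  then have "coeff (map_poly red (smult (inverse t) P)) i = 1 \<or> coeff (map_poly red (smult (inverse t) R)) i = 1"
    using \<open>t \<noteq> 0\<close> by auto
  then have "map_poly red (smult (inverse t) P) \<noteq> 0 \<or> map_poly red (smult (inverse t) R) \<noteq> 0"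
    by fastforce
  moreover have "red_pair nv red (P, R) = (map_poly red (smult (inverse t) P), map_poly red (smult (inverse t) R))"
    by (simp add: red_pair_def Let_def S_def t_def)
  ultimately show thesis using that[of "inverse t"] int \<open>t \<noteq> 0\<close> by simp
qed

end

section \<open>Reduction of a quadratic map\<close>


lemma fixed_finite_not_pole:
  assumes "rat_deg2 F G" "is_fixed F G (Some x)"
  shows "poly G x \<noteq> 0"
proof
  assume "poly G x = 0"
  then have "poly F x = 0" using assms(2) by (simp add: is_fixed_def fix_poly_def)
  then show False using assms(1) \<open>poly G x = 0\<close> coprime_poly_0[of F G x] by (simp add: rat_deg2_def)
qed

lemma fixed_infinity:
  assumes "rat_deg2 F G" "is_fixed F G None"
  shows "coeff G 2 = 0" "coeff F 2 \<noteq> 0"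
proof -
  have deg: "degree F \<le> 2" "degree G \<le> 2" "degree F = 2 \<or> degree G = 2"
    using assms(1) by (auto simp: rat_deg2_def max_def split: if_splits)
  have "coeff (fix_poly F G) 3 = coeff G 2"
    using deg(1) by (simp add: fix_poly_def coeff_pCons coeff_eq_0 numeral_3_eq_3 numeral_2_eq_2)
  then show G: "coeff G 2 = 0" using assms(2) by (simp add: is_fixed_def coeff_eq_0)
  then have "degree G \<noteq> 2" by (metis leading_coeff_0_iff degree_0 zero_neq_numeral)
  then have "degree F = 2" using deg(3) by simp
  then show "coeff F 2 \<noteq> 0" by (metis leading_coeff_0_iff degree_0 zero_neq_numeral)
qed

lemma conj_pair_degrees:
  assumes "degree F \<le> 2" "degree G \<le> 2"
  shows "degree (fst (conj_pair F G a c)) \<le> 2" "degree (snd (conj_pair F G a c)) \<le> 2"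
proof -
  have "degree (pcompose p [:a, c:]) \<le> 2" if "degree p \<le> 2" for p
    using that degree_pcompose_le[of p "[:a, c:]"] by (auto split: if_splits)
  then show "degree (fst (conj_pair F G a c)) \<le> 2" "degree (snd (conj_pair F G a c)) \<le> 2"
    using assms by (auto simp: conj_pair_def Let_def intro!: degree_diff_le order.trans[OF degree_smult_le])
qed

lemma sigma_fixed_triple:
  assumes "fixed_triple F G \<alpha>1 \<alpha>2 \<alpha>3"
  shows "sigma1 F G = multiplier F G \<alpha>1 + multiplier F G \<alpha>2 + multiplier F G \<alpha>3"
    "sigma2 F G = multiplier F G \<alpha>1 * multiplier F G \<alpha>2 + multiplier F G \<alpha>1 * multiplier F G \<alpha>3
      + multiplier F G \<alpha>2 * multiplier F G \<alpha>3"
proof -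
  let ?m = "multiplier F G"
  have "fix_mults F G = {#?m \<alpha>1, ?m \<alpha>2, ?m \<alpha>3#}" using assms by (simp add: fixed_triple_def)
  then have "sym_poly F G = [:?m \<alpha>1, 1:] * ([:?m \<alpha>2, 1:] * [:?m \<alpha>3, 1:])"
    unfolding sym_poly_def by (simp del: mult_pCons_left)
  then show "sigma1 F G = ?m \<alpha>1 + ?m \<alpha>2 + ?m \<alpha>3"
    "sigma2 F G = ?m \<alpha>1 * ?m \<alpha>2 + ?m \<alpha>1 * ?m \<alpha>3 + ?m \<alpha>2 * ?m \<alpha>3"
    by (simp_all add: sigma1_def sigma2_def coeff_pCons numeral_2_eq_2 algebra_simps)
qed

text \<open>The listing of fixed points is a parameter, while directions and multipliers do not
  depend on it; results for another order therefore speak about the same objects.\<close>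

locale quadratic_map = valued_field nv red
  for nv :: "'a::field \<Rightarrow> real" and red :: "'a \<Rightarrow> 'k::field_gcd" +
  fixes F G :: "'a poly" and a c :: 'a and \<alpha>1 \<alpha>2 \<alpha>3 :: "'a option"
  assumes deg2: "rat_deg2 F G" and c: "c \<noteq> 0" and triple: "fixed_triple F G \<alpha>1 \<alpha>2 \<alpha>3"
begin

abbreviation "\<delta> \<equiv> dir_cl nv red a c"
abbreviation "\<mu> \<equiv> multiplier F G"

lemma fixed_points: "is_fixed F G \<alpha> \<longleftrightarrow> \<alpha> \<in> {\<alpha>1, \<alpha>2, \<alpha>3}"
  using triple unfolding fixed_triple_def by blast

lemma fix_dirs: "fix_dirs nv red F G a c = {\<delta> \<alpha>1, \<delta> \<alpha>2, \<delta> \<alpha>3}"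
  unfolding fix_dirs_def using fixed_points by auto

text \<open>The passage from K to k. Over K the map still has degree 2, so each \<open>Q\<close> is
  nonzero there even if its residue is 0; this is what later permits clearing denominators.\<close>

lemma reduction_data:
  obtains f g f0 g0 e l D1 D2 D3 Q1 Q2 Q3 where
    "psi_red nv red F G a c = (f0, g0, e)"
    "reduced_quadratic f g f0 g0 e l (\<delta> \<alpha>1) (\<delta> \<alpha>2) (\<delta> \<alpha>3) (red Q1) (red Q2) (red Q3)"
    "nv Q1 \<le> 1" "nv Q2 \<le> 1" "nv Q3 \<le> 1" "nv D1 \<le> 1" "nv D2 \<le> 1" "nv D3 \<le> 1"
    "Q1 \<noteq> 0" "Q2 \<noteq> 0" "Q3 \<noteq> 0"
    "Q1 * \<mu> \<alpha>1 = Q1 - D1" "Q2 * \<mu> \<alpha>2 = Q2 - D2" "Q3 * \<mu> \<alpha>3 = Q3 - D3"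
    "red D1 = reduced_quadratic.D1 l (\<delta> \<alpha>1) (\<delta> \<alpha>2) (\<delta> \<alpha>3)"
    "red D2 = reduced_quadratic.D2 l (\<delta> \<alpha>1) (\<delta> \<alpha>2) (\<delta> \<alpha>3)"
    "red D3 = reduced_quadratic.D3 l (\<delta> \<alpha>1) (\<delta> \<alpha>2) (\<delta> \<alpha>3)"
proof -
  have degFG: "degree F \<le> 2" "degree G \<le> 2" using deg2 by (auto simp: rat_deg2_def)
  define P R where "P = fst (conj_pair F G a c)" and "R = snd (conj_pair F G a c)"
  have degPR: "degree P \<le> 2" "degree R \<le> 2" using conj_pair_degrees[OF degFG] by (simp_all add: P_def R_def)
  have "pcompose (fix_poly F G) [:a, c:] \<noteq> 0"
    using fix_poly_nonzero[OF deg2] c by (subst pcompose_eq_0_iff) auto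
  then have "fix_poly P R \<noteq> 0" using fix_poly_conj[of 1 F G a c] by (simp add: P_def R_def)
  then have "P \<noteq> 0 \<or> R \<noteq> 0" by (auto simp: fix_poly_def)
  then obtain s where s: "s \<noteq> 0" "red_pair nv red (P, R) = (map_poly red (smult s P), map_poly red (smult s R))"
    "integral_poly (smult s P)" "integral_poly (smult s R)"
    "map_poly red (smult s P) \<noteq> 0 \<or> map_poly red (smult s R) \<noteq> 0"
    using degPR by (rule red_pair_scaling)
  define F' G' where "F' = smult s P" and "G' = smult s R"
  define f g where "f = map_poly red F'" and "g = map_poly red G'"
  have deg': "degree F' \<le> 2" "degree G' \<le> 2" using degPR s(1) by (simp_all add: F'_def G'_def)
  have int': "integral_poly F'" "integral_poly G'" using s by (simp_all add: F'_def G'_def)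
  obtain f0 g0 e where e: "cancel_pair (f, g) = (f0, g0, e)" by (cases "cancel_pair (f, g)") auto
  have psi: "psi_red nv red F G a c = (f0, g0, e)"
    using s(2) e by (simp add: psi_red_def f_def g_def F'_def G'_def P_def R_def)
  define u v where "u \<alpha> = crd_x (coord_change a c \<alpha>)" and "v \<alpha> = crd_y (coord_change a c \<alpha>)" for \<alpha>
  define lin where "lin \<alpha> = [:- u \<alpha>, v \<alpha>:]" for \<alpha>
  have uv: "nv (u \<alpha>) \<le> 1" "nv (v \<alpha>) \<le> 1" "red (u \<alpha>) = proj_x (\<delta> \<alpha>)" "red (v \<alpha>) = proj_y (\<delta> \<alpha>)" for \<alpha>
    by (simp_all add: u_def v_def crd_integral red_crd)
  \<comment> \<open>Pulled back, each linear factor is a multiple of a primitive one; the scalars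
    are collected in the constant l.\<close>
  have lin_pcompose: "\<exists>k. pcompose [:- proj_x \<alpha>, proj_y \<alpha>:] [:a, c:] = smult k (lin \<alpha>)" for \<alpha>
    using pcompose_point[OF c, of \<alpha> a] crd_scale[of "coord_change a c \<alpha>"]
    unfolding lin_def u_def v_def by (metis smult_smult)
  obtain l0 where "fix_poly F G = smult l0 ([:- proj_x \<alpha>1, proj_y \<alpha>1:] * ([:- proj_x \<alpha>2, proj_y \<alpha>2:] * [:- proj_x \<alpha>3, proj_y \<alpha>3:]))"
    using triple by (auto simp: fixed_triple_def)
  moreover obtain k1 where "pcompose [:- proj_x \<alpha>1, proj_y \<alpha>1:] [:a, c:] = smult k1 (lin \<alpha>1)" using lin_pcompose by blast
  moreover obtain k2 where "pcompose [:- proj_x \<alpha>2, proj_y \<alpha>2:] [:a, c:] = smult k2 (lin \<alpha>2)" using lin_pcompose by blast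
  moreover obtain k3 where "pcompose [:- proj_x \<alpha>3, proj_y \<alpha>3:] [:a, c:] = smult k3 (lin \<alpha>3)" using lin_pcompose by blast
  ultimately have "fix_poly F' G' = smult (s * (l0 * (k3 * (k2 * k1)))) (lin \<alpha>1 * (lin \<alpha>2 * lin \<alpha>3))"
    using fix_poly_conj[of s F G a c]
    by (simp only: F'_def G'_def P_def R_def pcompose_smult pcompose_mult mult_smult_left mult_smult_right smult_smult mult.assoc)
  then obtain l where p: "fix_poly F' G' = smult l (lin \<alpha>1 * (lin \<alpha>2 * lin \<alpha>3))" by blast
  have int_lin: "integral_poly (lin \<alpha>)" "map_poly red (lin \<alpha>) = [:- proj_x (\<delta> \<alpha>), proj_y (\<delta> \<alpha>):]" for \<alpha>
    using integral_poly_linear[of "- u \<alpha>" "v \<alpha>"] uv[of \<alpha>] red_minus[of "u \<alpha>"] by (simp_all add: lin_def)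
  have lin_nz: "[:- proj_x \<epsilon>, proj_y \<epsilon>:] \<noteq> 0" for \<epsilon> :: "'k option" using proj_coords_nonzero[of \<epsilon>] by auto
  have int_prod: "integral_poly (lin \<alpha>1 * (lin \<alpha>2 * lin \<alpha>3))"
    "map_poly red (lin \<alpha>1 * (lin \<alpha>2 * lin \<alpha>3)) = [:- proj_x (\<delta> \<alpha>1), proj_y (\<delta> \<alpha>1):] *
      ([:- proj_x (\<delta> \<alpha>2), proj_y (\<delta> \<alpha>2):] * [:- proj_x (\<delta> \<alpha>3), proj_y (\<delta> \<alpha>3):])"
    by (simp_all only: integral_poly_mult int_lin)
  have X: "integral_poly [:0, 1:]" "map_poly red [:0, 1:] = [:0, 1:]"
    using integral_poly_linear[of 0 1] by simp_all
  have int_p: "integral_poly (fix_poly F' G')" "map_poly red (fix_poly F' G') = [:0, 1:] * g - f"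
    unfolding fix_poly_def f_def g_def by (simp_all only: integral_poly_diff integral_poly_mult int' X)
  \<comment> \<open>An argument as in Gauss's lemma: a non-integral l would make the product of
    primitive factors a small multiple of an integral polynomial, hence reduce to 0, but a product
    of nonzero polynomials over k is nonzero.\<close>
  have l: "nv l \<le> 1"
  proof (rule ccontr)
    assume l1: "\<not> nv l \<le> 1"
    then have "l \<noteq> 0" by auto
    then have "lin \<alpha>1 * (lin \<alpha>2 * lin \<alpha>3) = smult (inverse l) (fix_poly F' G')" by (simp add: p)
    moreover have "nv (inverse l) \<le> 1" using l1 by (simp add: nv_inverse inverse_le_1_iff)
    ultimately have "map_poly red (lin \<alpha>1 * (lin \<alpha>2 * lin \<alpha>3)) = 0"
      using integral_poly_smult[of "inverse l" "fix_poly F' G'"] int_p(1) red_inverse_eq_0[OF l1] by simp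
    then show False using lin_nz unfolding int_prod mult_eq_0_iff by blast
  qed
  have fixed_form: "[:0, 1:] * g - f = smult (red l) ([:- proj_x (\<delta> \<alpha>1), proj_y (\<delta> \<alpha>1):] *
      ([:- proj_x (\<delta> \<alpha>2), proj_y (\<delta> \<alpha>2):] * [:- proj_x (\<delta> \<alpha>3), proj_y (\<delta> \<alpha>3):]))"
    using int_p(2) unfolding p integral_poly_smult(2)[OF l int_prod(1)] int_prod(2) by simp
  \<comment> \<open>Stated for any fixed point singled out as first factor; it is applied three
    times with the factors permuted.\<close>
  have local: "\<exists>Q. Q \<noteq> 0 \<and> nv Q \<le> 1 \<and> form_eval 2 f (proj_x (\<delta> \<alpha>)) (proj_y (\<delta> \<alpha>)) = red Q * proj_x (\<delta> \<alpha>)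
      \<and> form_eval 2 g (proj_x (\<delta> \<alpha>)) (proj_y (\<delta> \<alpha>)) = red Q * proj_y (\<delta> \<alpha>)
      \<and> Q * \<mu> \<alpha> = Q - l * (u \<alpha> * v \<beta> - u \<beta> * v \<alpha>) * (u \<alpha> * v \<gamma> - u \<gamma> * v \<alpha>)"
    if \<alpha>: "is_fixed F G \<alpha>" and p\<alpha>: "fix_poly F' G' = smult l (lin \<alpha> * (lin \<beta> * lin \<gamma>))" for \<alpha> \<beta> \<gamma>
  proof -
    have dl: "degree (lin \<epsilon>) \<le> 1" for \<epsilon> by (simp add: lin_def)
    then have dR: "degree (lin \<beta> * lin \<gamma>) \<le> 2"
      by (meson degree_mult_le order.trans add_mono one_add_one[THEN eq_refl])
    have "v \<alpha> \<noteq> 0 \<Longrightarrow> poly G' (u \<alpha> / v \<alpha>) \<noteq> 0"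
    proof -
      assume "v \<alpha> \<noteq> 0"
      then obtain x where x: "\<alpha> = Some x" unfolding v_def crd_y_0 coord_change_def by auto
      have "proj_pt (u \<alpha>) (v \<alpha>) = Some ((x - a) / c)" by (simp add: u_def v_def proj_pt_crd coord_change_def x)
      then have "u \<alpha> / v \<alpha> = (x - a) / c" using \<open>v \<alpha> \<noteq> 0\<close> by (simp add: proj_pt_def)
      moreover have "poly G' ((x - a) / c) = s * (c * poly G x)"
        using c by (simp add: G'_def R_def conj_pair_def Let_def poly_pcompose)
      ultimately show ?thesis using fixed_finite_not_pole[OF deg2] \<alpha> x s(1) c by simp
    qed
    moreover have "v \<alpha> = 0 \<Longrightarrow> u \<alpha> = 1 \<and> coeff F' 2 \<noteq> 0"
    proof -
      assume "v \<alpha> = 0"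
      then have n: "\<alpha> = None" unfolding v_def crd_y_0 coord_change_def by simp
      have "coeff F' 2 = s * (c\<^sup>2 * coeff F 2)"
        using fixed_infinity[OF deg2] \<alpha> n coeff_2_pcompose_linear[OF degFG(1)] coeff_2_pcompose_linear[OF degFG(2)]
        by (simp add: F'_def P_def conj_pair_def Let_def)
      then show ?thesis using fixed_infinity[OF deg2] \<alpha> n s(1) c
        by (simp add: u_def coord_change_def crd_None)
    qed
    ultimately obtain Q where Q: "Q \<noteq> 0" "form_eval 2 F' (u \<alpha>) (v \<alpha>) = Q * u \<alpha>" "form_eval 2 G' (u \<alpha>) (v \<alpha>) = Q * v \<alpha>"
      "Q * multiplier F' G' (proj_pt (u \<alpha>) (v \<alpha>)) = Q - l * form_eval 2 (lin \<beta> * lin \<gamma>) (u \<alpha>) (v \<alpha>)"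
      using multiplier_formula[OF deg' dR p\<alpha>[unfolded lin_def[of \<alpha>]]] by blast
    \<comment> \<open>One of the coordinates is 1, so Q is itself a value of an integral form at an
      integral point.\<close>
    have "nv Q \<le> 1"
      using Q(2,3) form_eval_2_red(1)[OF int'(1) deg'(1) uv(1,2)[of \<alpha>]] form_eval_2_red(1)[OF int'(2) deg'(2) uv(1,2)[of \<alpha>]]
        crd_unit[of "coord_change a c \<alpha>"] by (auto simp: u_def v_def)
    moreover have "multiplier F' G' (proj_pt (u \<alpha>) (v \<alpha>)) = \<mu> \<alpha>"
    proof -
      have "\<alpha> = None \<Longrightarrow> coeff G 2 = 0" using fixed_infinity(1)[OF deg2] \<alpha> by simp
      from multiplier_conj[OF degFG s(1) c this, where a = a] show ?thesis
        by (simp add: F'_def G'_def P_def R_def u_def v_def proj_pt_crd)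
    qed
    moreover have "form_eval 2 (lin \<beta> * lin \<gamma>) (u \<alpha>) (v \<alpha>)
        = (u \<alpha> * v \<beta> - u \<beta> * v \<alpha>) * (u \<alpha> * v \<gamma> - u \<gamma> * v \<alpha>)"
      using form_eval_mult[OF dl dl, of \<beta> \<gamma> "u \<alpha>" "v \<alpha>"]
      unfolding lin_def form_eval_linear one_add_one by (simp add: mult.commute)
    moreover have "form_eval 2 f (proj_x (\<delta> \<alpha>)) (proj_y (\<delta> \<alpha>)) = red (Q * u \<alpha>)"
      using form_eval_2_red(2)[OF int'(1) deg'(1) uv(1,2)[of \<alpha>]] unfolding uv Q f_def .
    moreover have "form_eval 2 g (proj_x (\<delta> \<alpha>)) (proj_y (\<delta> \<alpha>)) = red (Q * v \<alpha>)"
      using form_eval_2_red(2)[OF int'(2) deg'(2) uv(1,2)[of \<alpha>]] unfolding uv Q g_def .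
    ultimately show ?thesis using Q(1,4) by (intro exI[of _ Q]) (simp add: red_mult uv)
  qed
  define D where "D \<alpha> \<beta> \<gamma> = l * (u \<alpha> * v \<beta> - u \<beta> * v \<alpha>) * (u \<alpha> * v \<gamma> - u \<gamma> * v \<alpha>)" for \<alpha> \<beta> \<gamma>
  have D: "nv (D \<alpha> \<beta> \<gamma>) \<le> 1" "red (D \<alpha> \<beta> \<gamma>) = red l * wedge (\<delta> \<alpha>) (\<delta> \<beta>) * wedge (\<delta> \<alpha>) (\<delta> \<gamma>)" for \<alpha> \<beta> \<gamma>
    using l uv by (simp_all add: D_def integral_closed red_mult red_diff wedge_def)
  obtain Q1 where Q1: "Q1 \<noteq> 0" "nv Q1 \<le> 1" "form_eval 2 f (proj_x (\<delta> \<alpha>1)) (proj_y (\<delta> \<alpha>1)) = red Q1 * proj_x (\<delta> \<alpha>1)"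
    "form_eval 2 g (proj_x (\<delta> \<alpha>1)) (proj_y (\<delta> \<alpha>1)) = red Q1 * proj_y (\<delta> \<alpha>1)" "Q1 * \<mu> \<alpha>1 = Q1 - D \<alpha>1 \<alpha>2 \<alpha>3"
    using local[of \<alpha>1 \<alpha>2 \<alpha>3] fixed_points p by (auto simp: D_def)
  have p2: "fix_poly F' G' = smult l (lin \<alpha>2 * (lin \<alpha>1 * lin \<alpha>3))"
    unfolding p by (simp only: mult.left_commute)
  obtain Q2 where Q2: "Q2 \<noteq> 0" "nv Q2 \<le> 1" "form_eval 2 f (proj_x (\<delta> \<alpha>2)) (proj_y (\<delta> \<alpha>2)) = red Q2 * proj_x (\<delta> \<alpha>2)"
    "form_eval 2 g (proj_x (\<delta> \<alpha>2)) (proj_y (\<delta> \<alpha>2)) = red Q2 * proj_y (\<delta> \<alpha>2)" "Q2 * \<mu> \<alpha>2 = Q2 - D \<alpha>2 \<alpha>1 \<alpha>3"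
    using local[of \<alpha>2 \<alpha>1 \<alpha>3] fixed_points p2 by (auto simp: D_def)
  have p3: "fix_poly F' G' = smult l (lin \<alpha>3 * (lin \<alpha>1 * lin \<alpha>2))"
    unfolding p by (simp only: mult.commute mult.left_commute)
  obtain Q3 where Q3: "Q3 \<noteq> 0" "nv Q3 \<le> 1" "form_eval 2 f (proj_x (\<delta> \<alpha>3)) (proj_y (\<delta> \<alpha>3)) = red Q3 * proj_x (\<delta> \<alpha>3)"
    "form_eval 2 g (proj_x (\<delta> \<alpha>3)) (proj_y (\<delta> \<alpha>3)) = red Q3 * proj_y (\<delta> \<alpha>3)" "Q3 * \<mu> \<alpha>3 = Q3 - D \<alpha>3 \<alpha>1 \<alpha>2"
    using local[of \<alpha>3 \<alpha>1 \<alpha>2] fixed_points p3 by (auto simp: D_def)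
  have deg_red: "degree f \<le> 2" "degree g \<le> 2"
    using deg' by (auto simp: f_def g_def coeff_eq_0 intro!: degree_le)
  have nz: "f \<noteq> 0 \<or> g \<noteq> 0" using s(5) by (simp add: f_def g_def F'_def G'_def)
  have rq: "reduced_quadratic f g f0 g0 e (red l) (\<delta> \<alpha>1) (\<delta> \<alpha>2) (\<delta> \<alpha>3) (red Q1) (red Q2) (red Q3)"
    using deg_red nz e fixed_form Q1(3,4) Q2(3,4) Q3(3,4) by unfold_locales
  show thesis
    by (rule that[OF psi rq Q1(2) Q2(2) Q3(2) D(1) D(1) D(1) Q1(1) Q2(1) Q3(1) Q1(5) Q2(5) Q3(5)])
      (simp_all add: D(2) reduced_quadratic.D1_def[OF rq] reduced_quadratic.D2_def[OF rq] reduced_quadratic.D3_def[OF rq])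
qed

end

section \<open>The crucial point\<close>


context quadratic_map
begin

abbreviation "\<psi> \<equiv> eval_red (psi_red nv red F G a c)"
abbreviation "s_proj w \<equiv> proj_eq (s_red nv red F G) w"

lemma W2_fixed_points:
  assumes "W2 nv red F G a c"
  obtains y z where "y \<noteq> z" "{x. \<psi> x = x} = {y, z}"
proof -
  obtain t p q r s where t: "t \<noteq> 1" "p * s - q * r \<noteq> 0"
    "\<And>z. \<psi> (mob_k p q r s z) = mob_k p q r s (map_option (\<lambda>x. t * x) z)"
    using assms by (auto simp: W2_def conj_red_to_def)
  show thesis
    using fixed_points_conj_scaling[of p s q r t \<psi>, OF t(2,1,3)] by (rule that[rotated])
qed

lemma W3_fixed_points:
  assumes "W3 nv red F G a c"
  obtains y where "{x. \<psi> x = x} = {y}"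
proof -
  obtain t p q r s where t: "t \<noteq> 0" "p * s - q * r \<noteq> 0"
    "\<And>z. \<psi> (mob_k p q r s z) = mob_k p q r s (map_option (\<lambda>x. x + t) z)"
    using assms by (auto simp: W3_def conj_red_to_def)
  show thesis
    using fixed_points_conj_translation[of p s q r t \<psi>, OF t(2,1,3)] by (rule that)
qed

text \<open>The common denominator is Q1 Q2 Q3. The residues are separate variables so that each
  case can insert the values it knows; the only thing left to check there is that the reduced triple
  is not zero.\<close>

lemma s_red_proj:
  assumes int: "nv Q1 \<le> 1" "nv Q2 \<le> 1" "nv Q3 \<le> 1" "nv D1 \<le> 1" "nv D2 \<le> 1" "nv D3 \<le> 1"
    and Q: "Q1 \<noteq> 0" "Q2 \<noteq> 0" "Q3 \<noteq> 0"
    and m: "Q1 * \<mu> \<alpha>1 = Q1 - D1" "Q2 * \<mu> \<alpha>2 = Q2 - D2" "Q3 * \<mu> \<alpha>3 = Q3 - D3"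
    and red: "red Q1 = q1" "red Q2 = q2" "red Q3 = q3" "red D1 = d1" "red D2 = d2" "red D3 = d3"
  defines "n1 \<equiv> (q1 - d1) * (q2 * q3) + (q2 - d2) * (q1 * q3) + (q3 - d3) * (q1 * q2)"
    and "n2 \<equiv> (q1 - d1) * (q2 - d2) * q3 + (q1 - d1) * (q3 - d3) * q2 + (q2 - d2) * (q3 - d3) * q1"
    and "n3 \<equiv> q1 * (q2 * q3)"
  assumes nz: "n1 \<noteq> 0 \<or> n2 \<noteq> 0 \<or> n3 \<noteq> 0"
  shows "s_proj w \<longleftrightarrow> proj_eq (n1, n2, n3) w"
proof -
  define N1 N2 M where "N1 = (Q1 - D1) * (Q2 * Q3) + (Q2 - D2) * (Q1 * Q3) + (Q3 - D3) * (Q1 * Q2)"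
    and "N2 = (Q1 - D1) * (Q2 - D2) * Q3 + (Q1 - D1) * (Q3 - D3) * Q2 + (Q2 - D2) * (Q3 - D3) * Q1"
    and "M = Q1 * (Q2 * Q3)"
  have intN: "nv N1 \<le> 1" "nv N2 \<le> 1" "nv M \<le> 1"
    using int by (simp_all add: N1_def N2_def M_def integral_closed)
  have redN: "red N1 = n1" "red N2 = n2" "red M = n3"
    using int by (simp_all add: N1_def N2_def M_def n1_def n2_def n3_def integral_closed red_add red_mult red_diff red)
  have "M \<noteq> 0" using Q by (simp add: M_def)
  have "sigma1 F G * M = N1" "sigma2 F G * M = N2"
    unfolding sigma_fixed_triple[OF triple] N1_def N2_def M_def m[symmetric] by (simp_all add: algebra_simps)
  then show ?thesis
    unfolding s_red_def using spec3_proj[OF intN \<open>M \<noteq> 0\<close>, of "sigma1 F G" "sigma2 F G" w] nz redN by simp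
qed

section \<open>The specialized point for each degree of the reduction\<close>

lemma good_reduction_case:
  assumes "deg_red nv red F G a c = 2"
  shows "\<exists>x y. \<forall>w. s_proj w \<longleftrightarrow> proj_eq (x, y, 1) w"
    and "W1 nv red F G a c" "\<not> W2 nv red F G a c" "\<not> W3 nv red F G a c" "\<not> W4 nv red F G a c"
proof -
  obtain f g f0 g0 e l D1 D2 D3 Q1 Q2 Q3 where r:
    "psi_red nv red F G a c = (f0, g0, e)"
    "reduced_quadratic f g f0 g0 e l (\<delta> \<alpha>1) (\<delta> \<alpha>2) (\<delta> \<alpha>3) (red Q1) (red Q2) (red Q3)"
    "nv Q1 \<le> 1" "nv Q2 \<le> 1" "nv Q3 \<le> 1" "nv D1 \<le> 1" "nv D2 \<le> 1" "nv D3 \<le> 1"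
    "Q1 \<noteq> 0" "Q2 \<noteq> 0" "Q3 \<noteq> 0"
    "Q1 * \<mu> \<alpha>1 = Q1 - D1" "Q2 * \<mu> \<alpha>2 = Q2 - D2" "Q3 * \<mu> \<alpha>3 = Q3 - D3"
    by (rule reduction_data)
  interpret rq: reduced_quadratic f g f0 g0 e l "\<delta> \<alpha>1" "\<delta> \<alpha>2" "\<delta> \<alpha>3" "red Q1" "red Q2" "red Q3" by fact
  have "e = 2" using assms r(1) by (simp add: deg_red_def)
  note gr = rq.good_reduction[OF this]
  define n1 n2 m where "n1 = (red Q1 - red D1) * (red Q2 * red Q3) + (red Q2 - red D2) * (red Q1 * red Q3) + (red Q3 - red D3) * (red Q1 * red Q2)"
    and "n2 = (red Q1 - red D1) * (red Q2 - red D2) * red Q3 + (red Q1 - red D1) * (red Q3 - red D3) * red Q2 + (red Q2 - red D2) * (red Q3 - red D3) * red Q1"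
    and "m = red Q1 * (red Q2 * red Q3)"
  have "m \<noteq> 0" using gr by (simp add: m_def)
  have "s_proj w \<longleftrightarrow> proj_eq (n1, n2, m) w" for w
    unfolding n1_def n2_def m_def using gr by (intro s_red_proj[OF r(3-14) refl refl refl refl refl refl]) simp
  moreover have "proj_eq (n1, n2, m) w \<longleftrightarrow> proj_eq (n1 / m, n2 / m, 1) w" for w
    using proj_eq_scale[OF \<open>m \<noteq> 0\<close>, of "n1 / m" "n2 / m" 1 w] \<open>m \<noteq> 0\<close> by simp
  ultimately show "\<exists>x y. \<forall>w. s_proj w \<longleftrightarrow> proj_eq (x, y, 1) w" by blast
  show "W1 nv red F G a c" "\<not> W4 nv red F G a c"
    using assms by (simp_all add: W1_def W4_def fixed_II_def)
  \<comment> \<open>All directions of classical fixed points are fixed here, so W2 would need three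
    fixed directions and W3 two, one more than their normal forms have.\<close>
  have sub: "fix_dirs nv red F G a c \<subseteq> {z. \<psi> z = z}" using gr by (auto simp: fix_dirs r(1))
  show "\<not> W2 nv red F G a c"
  proof
    assume W2: "W2 nv red F G a c"
    then obtain y z where "y \<noteq> z" "{x. \<psi> x = x} = {y, z}" by (rule W2_fixed_points)
    then have "card (fix_dirs nv red F G a c) \<le> 2"
      using sub card_mono[of "{y, z}" "fix_dirs nv red F G a c"] by simp
    then show False using W2 by (simp add: W2_def branch_fix_def)
  qed
  show "\<not> W3 nv red F G a c"
  proof
    assume W3: "W3 nv red F G a c"
    then obtain y where "{x. \<psi> x = x} = {y}" by (rule W3_fixed_points)
    then have "card (fix_dirs nv red F G a c) \<le> 1"
      using sub card_mono[of "{y}" "fix_dirs nv red F G a c"] by simp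
    then show False using W3 by (simp add: W3_def in_fix_tree_def)
  qed
qed

lemma constant_reduction_case:
  assumes "deg_red nv red F G a c = 0" "branch_fix nv red F G a c"
  shows "\<forall>w. s_proj w \<longleftrightarrow> proj_eq (0, 1, 0) w"
    and "\<not> W1 nv red F G a c" "\<not> W2 nv red F G a c" "\<not> W3 nv red F G a c" "W4 nv red F G a c"
proof -
  obtain f g f0 g0 e l D1 D2 D3 Q1 Q2 Q3 where r:
    "psi_red nv red F G a c = (f0, g0, e)"
    "reduced_quadratic f g f0 g0 e l (\<delta> \<alpha>1) (\<delta> \<alpha>2) (\<delta> \<alpha>3) (red Q1) (red Q2) (red Q3)"
    "nv Q1 \<le> 1" "nv Q2 \<le> 1" "nv Q3 \<le> 1" "nv D1 \<le> 1" "nv D2 \<le> 1" "nv D3 \<le> 1"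
    "Q1 \<noteq> 0" "Q2 \<noteq> 0" "Q3 \<noteq> 0"
    "Q1 * \<mu> \<alpha>1 = Q1 - D1" "Q2 * \<mu> \<alpha>2 = Q2 - D2" "Q3 * \<mu> \<alpha>3 = Q3 - D3"
    "red D1 = reduced_quadratic.D1 l (\<delta> \<alpha>1) (\<delta> \<alpha>2) (\<delta> \<alpha>3)"
    "red D2 = reduced_quadratic.D2 l (\<delta> \<alpha>1) (\<delta> \<alpha>2) (\<delta> \<alpha>3)"
    "red D3 = reduced_quadratic.D3 l (\<delta> \<alpha>1) (\<delta> \<alpha>2) (\<delta> \<alpha>3)"
    by (rule reduction_data)
  interpret rq: reduced_quadratic f g f0 g0 e l "\<delta> \<alpha>1" "\<delta> \<alpha>2" "\<delta> \<alpha>3" "red Q1" "red Q2" "red Q3" by fact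
  have "e = 0" using assms(1) r(1) by (simp add: deg_red_def)
  \<comment> \<open>Only three fixed points are available, so a branch point has them in three
    different directions.\<close>
  moreover have "\<delta> \<alpha>1 \<noteq> \<delta> \<alpha>2" "\<delta> \<alpha>1 \<noteq> \<delta> \<alpha>3" "\<delta> \<alpha>2 \<noteq> \<delta> \<alpha>3"
    using assms(2) by (auto simp: branch_fix_def fix_dirs card_insert_if split: if_splits)
  ultimately have cr: "rq.D1 \<noteq> 0" "rq.D2 \<noteq> 0" "rq.D3 \<noteq> 0"
    "(red Q1 = 0 \<and> red Q2 = 0 \<and> red Q3 = rq.D3) \<or> (red Q1 = 0 \<and> red Q3 = 0 \<and> red Q2 = rq.D2)
      \<or> (red Q2 = 0 \<and> red Q3 = 0 \<and> red Q1 = rq.D1)"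
    using rq.constant_reduction by blast+
  note proj = s_red_proj[OF r(3-14) refl refl refl r(15-17)]
  \<comment> \<open>In each case the only surviving term is (-D_i)(-D_j) Q_k with Q_k = D_k in the
    middle coordinate, so the scalar is the same in all three.\<close>
  let ?d = "rq.D1 * (rq.D2 * rq.D3)"
  have d: "?d \<noteq> 0" using cr(1-3) by simp
  have "s_proj w \<longleftrightarrow> proj_eq (?d * 0, ?d * 1, ?d * 0) w" for w
    using cr(4)
  proof (elim disjE conjE)
    assume q: "red Q1 = 0" "red Q2 = 0" "red Q3 = rq.D3"
    show ?thesis using proj[of w] cr(1-3) unfolding q by (simp add: mult_ac)
  next
    assume q: "red Q1 = 0" "red Q3 = 0" "red Q2 = rq.D2"
    show ?thesis using proj[of w] cr(1-3) unfolding q by (simp add: mult_ac)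
  next
    assume q: "red Q2 = 0" "red Q3 = 0" "red Q1 = rq.D1"
    show ?thesis using proj[of w] cr(1-3) unfolding q by (simp add: mult_ac)
  qed
  then show "\<forall>w. s_proj w \<longleftrightarrow> proj_eq (0, 1, 0) w" by (simp only: proj_eq_scale[OF d] simp_thms)
  show "\<not> W1 nv red F G a c" "\<not> W2 nv red F G a c" "\<not> W3 nv red F G a c" "W4 nv red F G a c"
    using assms by (simp_all add: W1_def W2_def W3_def W4_def fixed_II_def)
qed

lemma linear_reduction_case:
  assumes "deg_red nv red F G a c = 1" "\<psi> (\<delta> \<alpha>3) \<noteq> \<delta> \<alpha>3"
  shows "(\<exists>r. r \<noteq> 0 \<and> r + inverse r \<noteq> 2 \<and> (\<forall>w. s_proj w \<longleftrightarrow> proj_eq (1, r + inverse r, 0) w)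
      \<and> (\<exists>\<alpha>. is_fixed F G \<alpha> \<and> nv (\<mu> \<alpha>) = 1)
      \<and> (\<forall>\<alpha>. is_fixed F G \<alpha> \<and> nv (\<mu> \<alpha>) = 1 \<longrightarrow> red (\<mu> \<alpha>) + inverse (red (\<mu> \<alpha>)) = r + inverse r)
      \<and> W2 nv red F G a c \<and> \<not> W3 nv red F G a c)
    \<or> ((\<forall>w. s_proj w \<longleftrightarrow> proj_eq (1, 2, 0) w) \<and> \<not> W2 nv red F G a c \<and> W3 nv red F G a c)"
    and "\<not> W1 nv red F G a c" "\<not> W4 nv red F G a c"
proof -
  obtain f g f0 g0 e l D1 D2 D3 Q1 Q2 Q3 where r:
    "psi_red nv red F G a c = (f0, g0, e)"
    "reduced_quadratic f g f0 g0 e l (\<delta> \<alpha>1) (\<delta> \<alpha>2) (\<delta> \<alpha>3) (red Q1) (red Q2) (red Q3)"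
    "nv Q1 \<le> 1" "nv Q2 \<le> 1" "nv Q3 \<le> 1" "nv D1 \<le> 1" "nv D2 \<le> 1" "nv D3 \<le> 1"
    "Q1 \<noteq> 0" "Q2 \<noteq> 0" "Q3 \<noteq> 0"
    "Q1 * \<mu> \<alpha>1 = Q1 - D1" "Q2 * \<mu> \<alpha>2 = Q2 - D2" "Q3 * \<mu> \<alpha>3 = Q3 - D3"
    "red D1 = reduced_quadratic.D1 l (\<delta> \<alpha>1) (\<delta> \<alpha>2) (\<delta> \<alpha>3)"
    "red D2 = reduced_quadratic.D2 l (\<delta> \<alpha>1) (\<delta> \<alpha>2) (\<delta> \<alpha>3)"
    "red D3 = reduced_quadratic.D3 l (\<delta> \<alpha>1) (\<delta> \<alpha>2) (\<delta> \<alpha>3)"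
    by (rule reduction_data)
  interpret rq: reduced_quadratic f g f0 g0 e l "\<delta> \<alpha>1" "\<delta> \<alpha>2" "\<delta> \<alpha>3" "red Q1" "red Q2" "red Q3" by fact
  interpret rq: linear_reduction f g f0 g0 e l "\<delta> \<alpha>1" "\<delta> \<alpha>2" "\<delta> \<alpha>3" "red Q1" "red Q2" "red Q3"
    using assms r(1) by unfold_locales (simp_all add: deg_red_def)
  have \<psi>: "\<psi> = eval_red (f0, g0, e)" by (simp add: r(1))
  have q: "red Q1 \<noteq> 0" "red Q2 \<noteq> 0" "red Q3 = 0" "rq.D3 \<noteq> 0"
    using rq.Q_nonzero rq.moved_root(1) rq.simple_moved_root by auto
  \<comment> \<open>Residues of the multipliers at the two unmoved directions. The third multiplier
    has a pole on reduction, so it dominates: \<sigma>1 behaves like \<lambda>3 and \<sigma>2 like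
    \<lambda>3 (\<lambda>1 + \<lambda>2).\<close>
  define r1 r2 where "r1 = 1 - rq.D1 / red Q1" and "r2 = 1 - rq.D2 / red Q2"
  have r12: "red Q1 - rq.D1 = r1 * red Q1" "red Q2 - rq.D2 = r2 * red Q2"
    using q by (simp_all add: r1_def r2_def field_simps)
  have s: "s_proj w \<longleftrightarrow> proj_eq (1, r1 + r2, 0) w" for w
  proof -
    let ?k = "- rq.D3 * (red Q1 * red Q2)"
    have k: "?k \<noteq> 0" using q by simp
    have "s_proj w \<longleftrightarrow> proj_eq (?k * 1, ?k * (r1 + r2), ?k * 0) w"
      using s_red_proj[OF r(3-14) refl refl refl r(15-17), of w] k unfolding q(3) r12
      by (simp add: algebra_simps)
    then show ?thesis by (simp only: proj_eq_scale[OF k])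
  qed
  show "\<not> W1 nv red F G a c" "\<not> W4 nv red F G a c"
    using assms by (simp_all add: W1_def W4_def fixed_II_def)
  have fixed_set: "{z. \<psi> z = z} = {\<delta> \<alpha>1, \<delta> \<alpha>2}" using rq.fixed_roots by (auto simp: \<psi>)
  have fixed: "fixed_II nv red F G a c" using assms by (simp add: fixed_II_def)
  show "(\<exists>r. r \<noteq> 0 \<and> r + inverse r \<noteq> 2 \<and> (\<forall>w. s_proj w \<longleftrightarrow> proj_eq (1, r + inverse r, 0) w)
      \<and> (\<exists>\<alpha>. is_fixed F G \<alpha> \<and> nv (\<mu> \<alpha>) = 1)
      \<and> (\<forall>\<alpha>. is_fixed F G \<alpha> \<and> nv (\<mu> \<alpha>) = 1 \<longrightarrow> red (\<mu> \<alpha>) + inverse (red (\<mu> \<alpha>)) = r + inverse r)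
      \<and> W2 nv red F G a c \<and> \<not> W3 nv red F G a c)
    \<or> ((\<forall>w. s_proj w \<longleftrightarrow> proj_eq (1, 2, 0) w) \<and> \<not> W2 nv red F G a c \<and> W3 nv red F G a c)"
  proof (cases "\<delta> \<alpha>1 = \<delta> \<alpha>2")
    case True
    then have "rq.D1 = 0" "rq.D2 = 0" unfolding rq.D1_def rq.D2_def wedge_def by simp_all
    then have "r1 + r2 = 2" by (simp add: r1_def r2_def)
    moreover have "\<not> W2 nv red F G a c"
    proof
      assume "W2 nv red F G a c"
      then obtain y z where "y \<noteq> z" "{x. \<psi> x = x} = {y, z}" by (rule W2_fixed_points)
      then have "{y, z} = {\<delta> \<alpha>1, \<delta> \<alpha>1}" by (simp only: fixed_set flip: True)
      then show False using \<open>y \<noteq> z\<close> by (auto simp: doubleton_eq_iff)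
    qed
    moreover have "W3 nv red F G a c"
    proof -
      have "in_fix_tree nv red F G a c"
        using rq.moved_root_distinct True by (simp add: in_fix_tree_def fix_dirs)
      moreover obtain p q r s t where t: "p * s - q * r \<noteq> 0" "t \<noteq> 0"
        "\<forall>z. \<psi> (mob_k p q r s z) = mob_k p q r s (map_option (\<lambda>x. x + t) z)"
        using rq.conj_translation[OF True] unfolding \<psi> .
      then have "conj_red_to nv red F G a c (map_option (\<lambda>x. x + t))"
        unfolding conj_red_to_def by blast
      ultimately show ?thesis using fixed t(2) unfolding W3_def by blast
    qed
    ultimately show ?thesis using s by simp
  next
    case False
    then have D: "rq.D1 \<noteq> 0" "rq.D2 \<noteq> 0"
      using rq.l_nonzero rq.moved_root_distinct by (simp_all add: rq.D1_def rq.D2_def wedge_eq_0_iff)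
    \<comment> \<open>With Q3 reducing to 0 the fixed point formula loses a term and becomes, after
      rearrangement, r1 r2 = 1.\<close>
    have "rq.D3 * (red Q1 * rq.D2 + red Q2 * rq.D1) = rq.D3 * (rq.D1 * rq.D2)"
      using rq.holomorphic_fixed_point_formula unfolding q(3) by (simp add: algebra_simps)
    then have "red Q1 * rq.D2 + red Q2 * rq.D1 = rq.D1 * rq.D2" using q(4) by simp
    then have "(red Q1 - rq.D1) * (red Q2 - rq.D2) = red Q1 * red Q2" by (simp add: algebra_simps)
    then have "(r1 * r2) * (red Q1 * red Q2) = 1 * (red Q1 * red Q2)" unfolding r12 by (simp add: algebra_simps)
    then have r1r2: "r1 * r2 = 1" using q by (simp only: mult_cancel_right) simp
    then have r1: "r1 \<noteq> 0" "r2 \<noteq> 0" "r2 = inverse r1"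
      using inverse_unique[of r1 r2] by auto
    have "r1 \<noteq> 1" using D q by (simp add: r1_def)
    \<comment> \<open>The identity involves no division by 2 and so also covers residue
      characteristic 2.\<close>
    have "r1 + r2 \<noteq> 2"
    proof
      assume "r1 + r2 = 2"
      moreover have "(r1 - 1) * (r1 - 1) = 1 - r1 * r2 + r1 * ((r1 + r2) - 2)"
        by (simp add: algebra_simps mult_2)
      ultimately have "(r1 - 1) * (r1 - 1) = 0" using r1r2 by simp
      then show False using \<open>r1 \<noteq> 1\<close> by simp
    qed
    have mult: "nv (\<mu> \<alpha>) = 1 \<and> red (\<mu> \<alpha>) = r"
      if "nv Q \<le> 1" "nv D \<le> 1" "Q * \<mu> \<alpha> = Q - D" "red Q \<noteq> 0" "red Q - red D = r * red Q" "r \<noteq> 0" for Q D \<alpha> r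
    proof -
      have Q: "nv Q = 1" "Q \<noteq> 0" using that(1,4) by (auto simp: red_nonzero_iff)
      then have "\<mu> \<alpha> = (Q - D) / Q" using that(3) by (simp add: field_simps)
      then have i: "nv (\<mu> \<alpha>) \<le> 1" using Q that(1,2) by (simp add: nv_divide integral_closed)
      have "red (\<mu> \<alpha>) * red Q = r * red Q"
        using arg_cong[OF that(3), of red] that(1,2,5) i by (simp add: red_mult red_diff mult.commute)
      then have "red (\<mu> \<alpha>) = r" using that(4) by simp
      then show ?thesis using red_nonzero_iff[OF i] that(6) by simp
    qed
    have m1: "nv (\<mu> \<alpha>1) = 1" "red (\<mu> \<alpha>1) = r1"
      using mult[OF r(3,6,12) q(1), of r1] r12(1) r(15) r1(1) by simp_all
    have m2: "nv (\<mu> \<alpha>2) = 1" "red (\<mu> \<alpha>2) = r2"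
      using mult[OF r(4,7,13) q(2), of r2] r12(2) r(16) r1(2) by simp_all
    \<comment> \<open>A unit multiplier would make Q3 times it reduce to 0, while Q3 - D3 reduces to
      -D3. So the indifferent fixed points are among the other two, whose residues are inverse to
      each other.\<close>
    have m3: "nv (\<mu> \<alpha>3) \<noteq> 1"
    proof
      assume "nv (\<mu> \<alpha>3) = 1"
      then have "red (Q3 * \<mu> \<alpha>3) = 0" using r(5) q(3) by (simp add: red_mult)
      then show False using r(5,8,14,17) q(3,4) by (simp add: red_diff)
    qed
    have "\<not> W3 nv red F G a c"
    proof
      assume "W3 nv red F G a c"
      then obtain y where "{x. \<psi> x = x} = {y}" by (rule W3_fixed_points)
      then have "{\<delta> \<alpha>1, \<delta> \<alpha>2} = {y}" by (simp only: fixed_set)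
      then show False using False by (simp add: singleton_insert_inj_eq')
    qed
    moreover have "W2 nv red F G a c"
    proof -
      have "branch_fix nv red F G a c"
        using rq.moved_root_distinct False by (simp add: branch_fix_def fix_dirs)
      moreover obtain p q r s t where t: "p * s - q * r \<noteq> 0" "t \<noteq> 0" "t \<noteq> 1"
        "\<forall>z. \<psi> (mob_k p q r s z) = mob_k p q r s (map_option (\<lambda>x. t * x) z)"
        using rq.conj_scaling[OF False] unfolding \<psi> .
      then have "conj_red_to nv red F G a c (map_option (\<lambda>x. t * x))"
        unfolding conj_red_to_def by blast
      ultimately show ?thesis using fixed t(2,3) unfolding W2_def by blast
    qed
    moreover have "red (\<mu> \<alpha>) + inverse (red (\<mu> \<alpha>)) = r1 + inverse r1"
      if "is_fixed F G \<alpha>" "nv (\<mu> \<alpha>) = 1" for \<alpha>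
    proof -
      have "\<alpha> = \<alpha>1 \<or> \<alpha> = \<alpha>2" using that fixed_points m3 by blast
      then have "red (\<mu> \<alpha>) = r1 \<or> red (\<mu> \<alpha>) = inverse r1" using m1(2) m2(2) r1(3) by blast
      then show ?thesis by (elim disjE) (simp_all add: add.commute)
    qed
    moreover have "\<exists>\<alpha>. is_fixed F G \<alpha> \<and> nv (\<mu> \<alpha>) = 1" using fixed_points m1 by blast
    moreover have "\<forall>w. s_proj w \<longleftrightarrow> proj_eq (1, r1 + inverse r1, 0) w" "r1 + inverse r1 \<noteq> 2"
      using s \<open>r1 + r2 \<noteq> 2\<close> unfolding r1(3) by blast+
    ultimately show ?thesis using r1(1) by blast
  qed
qed

end

theorem theorem1p1:
  fixes nv :: "'a::field \<Rightarrow> real" and red :: "'a \<Rightarrow> 'k::field_gcd"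
    and F G :: "'a poly" and a c :: 'a
  assumes "nonarch_abs nv" and "nontrivial_abs nv" and "complete_abs nv"
    and "\<And>p :: 'a poly. degree p > 0 \<Longrightarrow> \<exists>x. poly p x = 0"
    and "residue_map nv red"
    and "rat_deg2 F G"
    and "c \<noteq> 0" and "weight nv red F G a c > 0"
  shows "((\<exists>x y. proj_eq (s_red nv red F G) (x, y, 1)) \<longleftrightarrow> W1 nv red F G a c)
    \<and> ((\<exists>x. x \<noteq> 2 \<and> proj_eq (s_red nv red F G) (1, x, 0)) \<longleftrightarrow> W2 nv red F G a c)
    \<and> (\<forall>x. x \<noteq> 2 \<and> proj_eq (s_red nv red F G) (1, x, 0) \<longrightarrow>
          (\<exists>\<alpha>. is_fixed F G \<alpha> \<and> nv (multiplier F G \<alpha>) = 1)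
        \<and> (\<forall>\<alpha>. is_fixed F G \<alpha> \<and> nv (multiplier F G \<alpha>) = 1 \<longrightarrow>
             x = red (multiplier F G \<alpha>) + inverse (red (multiplier F G \<alpha>))))
    \<and> (proj_eq (s_red nv red F G) (1, 2, 0) \<longleftrightarrow> W3 nv red F G a c)
    \<and> (proj_eq (s_red nv red F G) (0, 1, 0) \<longleftrightarrow> W4 nv red F G a c)"
proof -
  interpret valued_field nv red using assms(1,5) by unfold_locales
  \<comment> \<open>Kept for arbitrary listings, because the degree 1 case must reorder the fixed
    points.\<close>
  have qm: "quadratic_map nv red F G c \<alpha>1 \<alpha>2 \<alpha>3" if "fixed_triple F G \<alpha>1 \<alpha>2 \<alpha>3" for \<alpha>1 \<alpha>2 \<alpha>3
    using assms(6,7) that by unfold_locales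
  obtain \<alpha>1 \<alpha>2 \<alpha>3 where triple: "fixed_triple F G \<alpha>1 \<alpha>2 \<alpha>3"
    using fixed_triple_exists[OF assms(4,6)] by blast
  interpret quadratic_map nv red F G a c \<alpha>1 \<alpha>2 \<alpha>3 by (rule qm[OF triple])
  \<comment> \<open>Disjointness of the four loci; this turns the computed point of each case into
    the truth values of all four left-hand sides.\<close>
  have proj_eqs: "proj_eq (x, y, 1) (1, z, 0) = False" "proj_eq (x, y, 1) (0, 1, 0) = False"
    "proj_eq (1, x, 0) (y, z, 1) = False" "proj_eq (0, 1, 0) (y, z, 1) = False"
    "proj_eq (1, x, 0) (1, y, 0) \<longleftrightarrow> x = y" "proj_eq (1, x, 0) (0, 1, 0) = False"
    "proj_eq (0, 1, 0) (1, x, 0) = False" "proj_eq w w" for x y z :: 'k and w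
    by (auto simp: proj_eq_def intro: exI[of _ 1])
  consider "deg_red nv red F G a c = 0" | "deg_red nv red F G a c = 1" | "deg_red nv red F G a c \<ge> 2"
    by linarith
  then show ?thesis
  proof cases
    case 1
    \<comment> \<open>A point that is not fixed has positive weight only if it is a branch
      point.\<close>
    then have "branch_fix nv red F G a c"
      using assms(8) by (auto simp: weight_def fixed_II_def split: if_splits)
    note case0 = constant_reduction_case[OF 1 this]
    show ?thesis using case0 by (simp add: proj_eqs)
  next
    case 2
    \<comment> \<open>For degree 1 the term \<open>deg_red - 1\<close> is 0, so the whole weight
      comes from moved directions.\<close>
    then have "N_moved nv red F G a c > 0" using assms(8) by (simp add: weight_def fixed_II_def)
    then obtain \<epsilon> where "\<epsilon> \<in> fix_dirs nv red F G a c" "\<psi> \<epsilon> \<noteq> \<epsilon>"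
      unfolding N_moved_def card_gt_0_iff by blast
    then consider "\<psi> (\<delta> \<alpha>1) \<noteq> \<delta> \<alpha>1" | "\<psi> (\<delta> \<alpha>2) \<noteq> \<delta> \<alpha>2" | "\<psi> (\<delta> \<alpha>3) \<noteq> \<delta> \<alpha>3"
      unfolding fix_dirs by blast
    then obtain \<beta>1 \<beta>2 \<beta>3 where \<beta>: "fixed_triple F G \<beta>1 \<beta>2 \<beta>3" "\<psi> (\<delta> \<beta>3) \<noteq> \<delta> \<beta>3"
    proof cases
      case 1
      then show thesis using that fixed_triple_swap23[OF fixed_triple_swap12[OF triple]] by blast
    next
      case 2
      then show thesis using that fixed_triple_swap23[OF triple] by blast
    next
      case 3
      then show thesis using that triple by blast
    qed
    note case1 = quadratic_map.linear_reduction_case[OF qm[OF \<beta>(1)] 2 \<beta>(2)]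
    from case1(1) show ?thesis
    proof (rule disjE)
      assume "\<exists>r. r \<noteq> 0 \<and> r + inverse r \<noteq> 2 \<and> (\<forall>w. s_proj w \<longleftrightarrow> proj_eq (1, r + inverse r, 0) w)
        \<and> (\<exists>\<alpha>. is_fixed F G \<alpha> \<and> nv (\<mu> \<alpha>) = 1)
        \<and> (\<forall>\<alpha>. is_fixed F G \<alpha> \<and> nv (\<mu> \<alpha>) = 1 \<longrightarrow> red (\<mu> \<alpha>) + inverse (red (\<mu> \<alpha>)) = r + inverse r)
        \<and> W2 nv red F G a c \<and> \<not> W3 nv red F G a c"
      then obtain r where r: "r + inverse r \<noteq> 2" "\<forall>w. s_proj w \<longleftrightarrow> proj_eq (1, r + inverse r, 0) w"
        "\<exists>\<alpha>. is_fixed F G \<alpha> \<and> nv (\<mu> \<alpha>) = 1"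
        "\<forall>\<alpha>. is_fixed F G \<alpha> \<and> nv (\<mu> \<alpha>) = 1 \<longrightarrow> red (\<mu> \<alpha>) + inverse (red (\<mu> \<alpha>)) = r + inverse r"
        "W2 nv red F G a c" "\<not> W3 nv red F G a c"
        by blast
      show ?thesis using r case1(2,3) by (auto simp: proj_eqs)
    next
      assume "(\<forall>w. s_proj w \<longleftrightarrow> proj_eq (1, 2, 0) w) \<and> \<not> W2 nv red F G a c \<and> W3 nv red F G a c"
      then show ?thesis using case1(2,3) by (simp add: proj_eqs)
    qed
  next
    case 3
    \<comment> \<open>The degree returned by \<open>cancel_pair\<close> is 2 minus natural numbers,
      hence at most 2.\<close>
    then have "deg_red nv red F G a c = 2"
      by (auto simp: deg_red_def psi_red_def cancel_pair_def Let_def)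
    note case2 = good_reduction_case[OF this]
    then obtain x y where s: "\<forall>w. s_proj w \<longleftrightarrow> proj_eq (x, y, 1) w" by blast
    then have "\<exists>x y. s_proj (x, y, 1)" using proj_eqs(8) by blast
    then show ?thesis using case2(2-5) s by (simp add: proj_eqs(1,2))
  qed
qed

end
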